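(* Flattening and inflating are inverse operations. More precisely: \begin{enumerate}[(i)] \item if $e$ is a $k$-boundary edge of a $k$-triangulation $T$ of the $(n+1)$-gon, and $E$ denotes the $k$-crossing of $\underline{T}_e$ consisting of the edges that arise as the gluing of two edges of $T$ (namely the edges $[s_i,s_{k+i}]$, $1\le i\le k$, each obtained from $[s_{i-1},s_{k+i}]$ and $[s_i,s_{k+i}]$), then inflating $E$ at its $k$ consecutive vertices $s_1,\dots,s_k$ in $\underline{T}_e$ gives back $T$, i.e. $\overline{\underline{T}_e}^E=T$; \item if $T$ is a $k$-triangulation of the $n$-gon and $E$ is a $k$-crossing of $T$ with $k$ consecutive vertices $s_1,\ldots,s_k$, and $e$ denotes the edge $[s_0,s_k]$ of $\overline{T}^E$, then $\underline{\overline{T}^E}_e=T$. \end{enumerate}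
   Context: Vertices of a convex polygon lie on the unit circle, labelled counterclockwise; $u\prec v\prec w$ denotes counterclockwise order ($\preccurlyeq$ allows equality). Edges cross if their open segments intersect; an $\ell$-crossing is a set of $\ell$ mutually crossing edges; a $k$-triangulation is a maximal $(k+1)$-crossing-free edge set. An edge of cyclic length $k$ is a $k$-boundary edge. A $k$-star is a set of edges $\{[s_j,s_{j+k}]: j\in\mathbb{Z}_{2k+1}\}$ with $s_0\prec\dots\prec s_{2k}\prec s_0$; every $k$-boundary edge of a $k$-triangulation lies in a unique $k$-star of it. Flattening: let $T$ be a $k$-triangulation of the $(n+1)$-gon and $e=[s_0,s_0+k]$ a $k$-boundary edge of $T$; let $s_0,s_1=s_0+1,\ldots,s_k=s_0+k,s_{k+1},\ldots,s_{2k}$ be the vertices (in circle order) of the unique $k$-star of $T$ containing $e$. The flattening $\underline{T}_e$ is the edge set on the vertex set $V_{n+1}\setminus\{s_0\}$ obtained by: (i) copying every edge of $T$ with no vertex in $\{s_0,\ldots,s_k\}$; (ii) forgetting the edges $[s_0,s_i]$, $1\le i\le k$; (iii) replacing each edge $[s_i,t]$ with $0\le i\le k$ by $[s_i,t]$ if $s_k\prec t\preccurlyeq s_{k+i}$, and by $[s_{i+1},t]$ if $s_{k+i+1}\preccurlyeq t\prec s_0$. It is a $k$-triangulation of the $n$-gon. Inflating: let $T$ be a $k$-triangulation of the $n$-gon and $E$ a $k$-crossing of $T$ with edges $[s_1,s_{1+k}],\ldots,[s_k,s_{2k}]$, $s_1\prec s_2\prec\dots\prec s_{2k}$, such that $s_1,\ldots,s_k$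 are consecutive ($s_k=s_1+k-1$). Let $s_0$ be a new vertex on the circle between $s_1-1$ and $s_1$. The inflating $\overline{T}^E$ (of $E$ at $s_1,\dots,s_k$) is the edge set on $V_n\cup\{s_0\}$ obtained by: (i) copying every edge of $T$ with no vertex in $\{s_1,\ldots,s_k\}$; (ii) adding the edges $[s_0,s_i]$, $1\le i\le k$; (iii) replacing each edge $[s_i,t]$ with $1\le i\le k$ by $[s_i,t]$ if $s_k\prec t\preccurlyeq s_{k+i}$, and by $[s_{i-1},t]$ if $s_{k+i}\preccurlyeq t\prec s_1$. It is a $k$-triangulation of the $(n+1)$-gon.
   Formalization: In both operations the edges [s_i,s_j] with 1≤i<j≤k, which rules (i)–(iii) do not cover, are kept unchanged (dropping them makes the claim false for k≥2); also k≥1, and in (i) the (n+1)-gon has at least 2k+1 vertices so that the k-star exists. *)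

theory Defs
  imports "HOL-Analysis.Analysis"
begin

text \<open>
  The vertices of a convex polygon are an arbitrary finite set of points of the unit circle, so that
  a vertex can be deleted or inserted without relabelling the others. Edges are two-element sets.
\<close>

definition polygon :: "nat \<Rightarrow> complex set \<Rightarrow> bool" where
  "polygon n V \<longleftrightarrow> finite V \<and> V \<subseteq> sphere 0 1 \<and> card V = n"

definition edges :: "complex set \<Rightarrow> complex set set" where
  "edges V = {{u, v} | u v. u \<in> V \<and> v \<in> V \<and> u \<noteq> v}"

text \<open>The counterclockwise angle from \<open>u\<close> to \<open>v\<close>, in the interval from \<open>0\<close> to \<open>2 * pi\<close>.\<close>

definition ang :: "complex \<Rightarrow> complex \<Rightarrow> real" where
  "ang u v = Arg2pi (v / u)"

text \<open>The order \<open>s a \<prec> s (a+1) \<prec> \<dots> \<prec> s b \<prec> s a\<close>.\<close>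

definition ccw_seq :: "(nat \<Rightarrow> complex) \<Rightarrow> nat \<Rightarrow> nat \<Rightarrow> bool" where
  "ccw_seq s a b \<longleftrightarrow>
     s ` {a..b} \<subseteq> sphere 0 1 \<and> strict_mono_on {a..b} (\<lambda>j. ang (s a) (s j))"

text \<open>
  The points \<open>t\<close> of the circle with \<open>a \<prec> t \<preceq> b\<close>, \<open>a \<preceq> t \<prec> b\<close> and \<open>a \<prec> t \<prec> b\<close>;
  all three arcs are empty when \<open>a = b\<close>.
\<close>

definition arc_oc :: "complex \<Rightarrow> complex \<Rightarrow> complex set" where
  "arc_oc a b = {t \<in> sphere 0 1. 0 < ang a t \<and> ang a t \<le> ang a b}"

definition arc_co :: "complex \<Rightarrow> complex \<Rightarrow> complex set" where
  "arc_co a b = {t \<in> sphere 0 1. ang a t < ang a b}"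

definition arc_oo :: "complex \<Rightarrow> complex \<Rightarrow> complex set" where
  "arc_oo a b = {t \<in> sphere 0 1. 0 < ang a t \<and> ang a t < ang a b}"

text \<open>
  \<open>shift V u j\<close> is the vertex \<open>u + j\<close>, reached from \<open>u\<close> after \<open>j\<close> counterclockwise steps in \<open>V\<close>.
\<close>

definition ccw_succ :: "complex set \<Rightarrow> complex \<Rightarrow> complex" where
  "ccw_succ V u = arg_min_on (ang u) (V - {u})"

definition shift :: "complex set \<Rightarrow> complex \<Rightarrow> nat \<Rightarrow> complex" where
  "shift V u j = (ccw_succ V ^^ j) u"

definition crosses :: "complex set \<Rightarrow> complex set \<Rightarrow> bool" where
  "crosses e f \<longleftrightarrow> e \<noteq> f \<and>
     (\<exists>u v w x. e = {u, v} \<and> f = {w, x} \<and> open_segment u v \<inter> open_segment w x \<noteq> {})"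

definition crossing :: "nat \<Rightarrow> complex set set \<Rightarrow> bool" where
  "crossing l E \<longleftrightarrow> finite E \<and> card E = l \<and> pairwise crosses E"

definition crossing_free :: "nat \<Rightarrow> complex set set \<Rightarrow> bool" where
  "crossing_free l T \<longleftrightarrow> (\<forall>E. E \<subseteq> T \<longrightarrow> \<not> crossing l E)"

definition k_triangulation :: "nat \<Rightarrow> complex set \<Rightarrow> complex set set \<Rightarrow> bool" where
  "k_triangulation k V T \<longleftrightarrow> T \<subseteq> edges V \<and> crossing_free (k + 1) T \<and>
     (\<forall>T'. T \<subset> T' \<and> T' \<subseteq> edges V \<longrightarrow> \<not> crossing_free (k + 1) T')"

definition edge_length :: "complex set \<Rightarrow> complex set \<Rightarrow> nat" where
  "edge_length V e = (LEAST j. \<exists>u\<in>V. e = {u, shift V u j})"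

definition boundary_edge :: "nat \<Rightarrow> complex set \<Rightarrow> complex set \<Rightarrow> bool" where
  "boundary_edge k V e \<longleftrightarrow> e \<in> edges V \<and> edge_length V e = k"

definition k_star :: "nat \<Rightarrow> complex set set \<Rightarrow> bool" where
  "k_star k S \<longleftrightarrow> (\<exists>s. ccw_seq s 0 (2 * k) \<and>
     S = {{s j, s ((j + k) mod (2 * k + 1))} | j. j < 2 * k + 1})"

definition star_of :: "nat \<Rightarrow> complex set set \<Rightarrow> complex set \<Rightarrow> complex set set" where
  "star_of k T e = (THE S. k_star k S \<and> S \<subseteq> T \<and> e \<in> S)"

text \<open>
  The endpoint \<open>u\<close> of \<open>e = [u, u + k]\<close>; it is unique as soon as \<open>V\<close> does not have exactly \<open>2 * k\<close>
  vertices.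
\<close>

definition first_vertex :: "nat \<Rightarrow> complex set \<Rightarrow> complex set \<Rightarrow> complex" where
  "first_vertex k V e = (THE u. u \<in> V \<and> e = {u, shift V u k})"

text \<open>
  The vertices \<open>s\<^sub>0, s\<^sub>1, \<dots>, s\<^sub>2\<^sub>k\<close> of the star of \<open>e\<close>, listed counterclockwise from \<open>s\<^sub>0\<close>, where
  \<open>e = [s\<^sub>0, s\<^sub>0 + k]\<close>. The sequence is periodic: index \<open>2 * k + 1\<close> gives \<open>s\<^sub>0\<close> again.
\<close>

definition star_vertex ::
    "nat \<Rightarrow> complex set \<Rightarrow> complex set set \<Rightarrow> complex set \<Rightarrow> nat \<Rightarrow> complex" where
  "star_vertex k V T e j = shift (\<Union>(star_of k T e)) (first_vertex k V e) j"

text \<open>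
  \<open>flatten_step k s f g\<close>: the edge \<open>f\<close> gives rise to the edge \<open>g\<close> when flattening along the star with
  vertices \<open>s\<close>. No step starts from an edge \<open>[s\<^sub>0, s\<^sub>i]\<close> with \<open>1 \<le> i \<le> k\<close>: such edges are forgotten.
  The edges joining two of \<open>s\<^sub>1, \<dots>, s\<^sub>k\<close>, of length less than \<open>k\<close>, belong to every \<open>k\<close>-triangulation and
  are kept, here and in the inflating below.
\<close>

definition flatten_step ::
    "nat \<Rightarrow> (nat \<Rightarrow> complex) \<Rightarrow> complex set \<Rightarrow> complex set \<Rightarrow> bool" where
  "flatten_step k s f g \<longleftrightarrow>
     f \<inter> s ` {0..k} = {} \<and> g = f \<or>
     f \<subseteq> s ` {1..k} \<and> g = f \<or>
     (\<exists>i t. i \<le> k \<and> f = {s i, t} \<and>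
        (t \<in> arc_oc (s k) (s (k + i)) \<and> g = {s i, t} \<or>
         t \<in> arc_co (s (k + i + 1)) (s 0) \<and> g = {s (i + 1), t}))"

definition flattening ::
    "nat \<Rightarrow> complex set \<Rightarrow> complex set set \<Rightarrow> complex set \<Rightarrow> complex set set" where
  "flattening k V T e = {g. \<exists>f\<in>T. flatten_step k (star_vertex k V T e) f g}"

definition glued_edges ::
    "nat \<Rightarrow> complex set \<Rightarrow> complex set set \<Rightarrow> complex set \<Rightarrow> complex set set" where
  "glued_edges k V T e =
     {g. \<exists>f\<in>T. \<exists>f'\<in>T. f \<noteq> f' \<and> flatten_step k (star_vertex k V T e) f g \<and>
        flatten_step k (star_vertex k V T e) f' g}"

text \<open>
  The vertices \<open>s\<^sub>1, \<dots>, s\<^sub>2\<^sub>k\<close> of the crossing \<open>E\<close>, listed counterclockwise from \<open>s\<^sub>1\<close>, preceded by \<open>s\<^sub>0\<close>.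
\<close>

definition crossing_vertex :: "complex set set \<Rightarrow> complex \<Rightarrow> complex \<Rightarrow> nat \<Rightarrow> complex" where
  "crossing_vertex E s1 s0 j = (if j = 0 then s0 else shift (\<Union>E) s1 (j - 1))"

text \<open>
  \<open>E\<close> is a \<open>k\<close>-crossing of \<open>T\<close> with edges \<open>[s\<^sub>i, s\<^sub>k\<^sub>+\<^sub>i]\<close>, \<open>1 \<le> i \<le> k\<close>, such that \<open>s\<^sub>1, \<dots>, s\<^sub>k\<close> are
  consecutive in \<open>V\<close>.
\<close>

definition consecutive_crossing ::
    "nat \<Rightarrow> complex set \<Rightarrow> complex set set \<Rightarrow> complex set set \<Rightarrow> complex \<Rightarrow> bool" where
  "consecutive_crossing k V T E s1 \<longleftrightarrow>
     E \<subseteq> T \<and> crossing k E \<and> s1 \<in> \<Union>E \<and>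
     E = {{shift (\<Union>E) s1 (i - 1), shift (\<Union>E) s1 (k + i - 1)} | i. i \<in> {1..k}} \<and>
     shift (\<Union>E) s1 (k - 1) = shift V s1 (k - 1)"

text \<open>\<open>s0\<close> lies on the circle strictly between the vertices \<open>s1 - 1\<close> and \<open>s1\<close> of \<open>V\<close>.\<close>

definition new_vertex :: "complex set \<Rightarrow> complex \<Rightarrow> complex \<Rightarrow> bool" where
  "new_vertex V s1 s0 \<longleftrightarrow> (\<exists>p\<in>V. ccw_succ V p = s1 \<and> s0 \<in> arc_oo p s1)"

text \<open>
  Both \<open>E\<close> and \<open>s1\<close> are arguments of the inflating because the same crossing may have several runs of
  \<open>k\<close> consecutive vertices at which it can be inflated.
\<close>

definition inflating ::
    "nat \<Rightarrow> complex set set \<Rightarrow> complex set set \<Rightarrow> complex \<Rightarrow> complex \<Rightarrow> complex set set" where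
  "inflating k T E s1 s0 = (let s = crossing_vertex E s1 s0 in
     {f \<in> T. f \<inter> s ` {1..k} = {}} \<union>
     {f \<in> T. f \<subseteq> s ` {1..k}} \<union>
     {{s 0, s i} | i. i \<in> {1..k}} \<union>
     {{s i, t} | i t. i \<in> {1..k} \<and> {s i, t} \<in> T \<and> t \<in> arc_oc (s k) (s (k + i))} \<union>
     {{s (i - 1), t} | i t. i \<in> {1..k} \<and> {s i, t} \<in> T \<and> t \<in> arc_co (s (k + i)) (s 1)})"

end

theory Submission
  imports Defs
begin

text \<open>
  Label the vertices counterclockwise from \<open>s\<^sub>0\<close> by \<open>0, \<dots>, N - 1\<close>. Edges become pairs \<open>a < b\<close>, two edges
  cross when their pairs interleave, and flattening and inflating move the edges between the rows
  \<open>0, \<dots>, k\<close> and the columns beyond \<open>k\<close> by one row. Writing \<open>b\<^sub>i\<close> for the column of \<open>s\<^sub>k\<^sub>+\<^sub>i\<close>, the edges of row \<open>i\<close>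
  are kept up to \<open>b\<^sub>i\<close> and moved from \<open>b\<^sub>i\<^sub>+\<^sub>1\<close> on, and no edge lies in between since it would bisect an angle
  of the star and complete \<open>k\<close> of its edges to a \<open>(k + 1)\<close>-crossing. Hence the two operations undo each
  other as soon as the star through \<open>[s\<^sub>0, s\<^sub>k]\<close> exists and is unique. For the existence one chooses
  \<open>b\<^sub>k, \<dots>, b\<^sub>1\<close> greedily, \<open>b\<^sub>i\<close> being the last neighbour of \<open>i\<close> before \<open>b\<^sub>i\<^sub>+\<^sub>1\<close>; an exchange argument shows that
  \<open>[i - 1, b\<^sub>i]\<close> is then an edge as well.
\<close>

section \<open>Crossings of index pairs\<close>

text \<open>Flattening obtains the star vertices through definite descriptions, so neither round
  trip can be computed before these are evaluated. Both round trips rest on the same two facts, that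
  the star lies in the edge set and that its angles contain no edge, but the facts have different
  origins: before flattening they must be extracted from maximality and crossing-freeness, after
  inflating they can be read off the construction. Reading \<open>N\<close> as a second index of
  \<open>s\<^sub>0\<close> lets row \<open>k\<close> obey the same rule as the other rows, with an
  empty range of moved edges. The kept range of row \<open>i\<close> and the moved range of row
  \<open>i - 1\<close> share exactly the column of \<open>s\<^sub>k\<^sub>+\<^sub>i\<close>. This is
  where two edges are glued, and it is why the glued edges suffice to undo the flattening.\<close>

definition interleave :: "nat \<times> nat \<Rightarrow> nat \<times> nat \<Rightarrow> bool" where
  "interleave x y \<longleftrightarrow>
     fst x < fst y \<and> fst y < snd x \<and> snd x < snd y \<or>
     fst y < fst x \<and> fst x < snd y \<and> snd y < snd x"

definition index_crossing :: "nat \<Rightarrow> (nat \<times> nat) set \<Rightarrow> bool" where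
  "index_crossing l C \<longleftrightarrow> finite C \<and> card C = l \<and> pairwise interleave C"

lemma interleave_distinct:
  "interleave x y \<Longrightarrow> fst x \<noteq> fst y \<and> snd x \<noteq> snd y \<and> fst x \<noteq> snd y \<and> snd x \<noteq> fst y"
  by (auto simp: interleave_def)

text \<open>Interleaving pairs are distinct, so the hypothesis already makes \<open>g\<close>
  injective and no pair is lost in the image.\<close>

lemma index_crossing_image:
  assumes "finite A" "\<And>x y. x \<in> A \<Longrightarrow> y \<in> A \<Longrightarrow> x \<noteq> y \<Longrightarrow> interleave (g x) (g y)"
  shows "index_crossing (card A) (g ` A)"
proof -
  have "inj_on g A"
    using assms(2) interleave_distinct by (metis inj_onI)
  then show ?thesis
    using assms by (auto simp: index_crossing_def card_image pairwise_def)
qed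

text \<open>Each of the other \<open>k\<close> pairs has an endpoint strictly between
  \<open>a\<close> and \<open>b\<close>, and these endpoints are distinct.\<close>

lemma index_crossing_long:
  assumes C: "index_crossing (k + 1) C" and ab: "(a, b) \<in> C" "a < b"
  shows "a + k < b"
proof -
  let ?f = "\<lambda>x. if a < fst x \<and> fst x < b then fst x else snd x"
  have int: "interleave x (a, b)" if "x \<in> C - {(a, b)}" for x
    using C ab that by (auto simp: index_crossing_def pairwise_def)
  have "inj_on ?f (C - {(a, b)})"
  proof (rule inj_onI)
    fix x y
    assume xy: "x \<in> C - {(a, b)}" "y \<in> C - {(a, b)}" "?f x = ?f y"
    show "x = y"
    proof (rule ccontr)
      assume "x \<noteq> y"
      then have "interleave x y"
        using C xy by (auto simp: index_crossing_def pairwise_def)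
      then show False
        using interleave_distinct[of x y] xy(3) by presburger
    qed
  qed
  moreover have "?f ` (C - {(a, b)}) \<subseteq> {a<..<b}"
    using int by (fastforce simp: interleave_def)
  ultimately have "card (C - {(a, b)}) \<le> card {a<..<b}"
    using card_inj_on_le finite_greaterThanLessThan by blast
  moreover have "card (C - {(a, b)}) = k"
    using C ab by (simp add: index_crossing_def)
  ultimately show ?thesis
    using ab(2) by simp
qed

section \<open>Triangulations as maximal sets of index pairs\<close>

locale index_triangulation =
  fixes k N :: nat and F :: "(nat \<times> nat) set"
  assumes pairs: "\<And>a b. (a, b) \<in> F \<Longrightarrow> a < b \<and> b < N"
    and free: "\<And>C. C \<subseteq> F \<Longrightarrow> \<not> index_crossing (k + 1) C"
    and maximal: "\<And>a b. a < b \<Longrightarrow> b < N \<Longrightarrow> (a, b) \<notin> F \<Longrightarrow>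
      \<exists>C. C \<subseteq> insert (a, b) F \<and> index_crossing (k + 1) C"
begin

lemma blocking_crossing:
  assumes "a < b" "b < N" "(a, b) \<notin> F"
  obtains C where "C \<subseteq> insert (a, b) F" "(a, b) \<in> C" "index_crossing (k + 1) C"
  using maximal[OF assms] free by blast

text \<open>A missing pair belongs to a crossing of \<open>k + 1\<close> pairs that blocks it, and
  members of such a crossing are longer than \<open>k\<close>.\<close>

lemma short_pair: "a < b \<Longrightarrow> b < N \<Longrightarrow> b \<le> a + k \<Longrightarrow> (a, b) \<in> F"
  using blocking_crossing index_crossing_long by (metis linorder_not_less)

end

text \<open>\<open>b i\<close> is the column of the star vertex \<open>s\<^sub>k\<^sub>+\<^sub>i\<close>, chosen greedily from \<open>i = k\<close> downwards.\<close>

locale greedy_columns = index_triangulation +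
  fixes b :: "nat \<Rightarrow> nat"
  assumes b_end: "b (k + 1) = N"
    and b_mem: "\<And>i. 1 \<le> i \<Longrightarrow> i \<le> k \<Longrightarrow> (i, b i) \<in> F"
    and b_ge: "\<And>i. 1 \<le> i \<Longrightarrow> i \<le> k \<Longrightarrow> k + i \<le> b i"
    and b_less: "\<And>i. 1 \<le> i \<Longrightarrow> i \<le> k \<Longrightarrow> b i < b (i + 1)"
    and b_last: "\<And>i t. 1 \<le> i \<Longrightarrow> i \<le> k \<Longrightarrow> b i < t \<Longrightarrow> t < b (i + 1) \<Longrightarrow> (i, t) \<notin> F"
begin

lemma b_strict: "1 \<le> i \<Longrightarrow> i < j \<Longrightarrow> j \<le> k + 1 \<Longrightarrow> b i < b j"
proof (induction j)
  case (Suc j)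
  show ?case
  proof (cases "i = j")
    case True
    then show ?thesis using b_less Suc.prems by simp
  next
    case False
    then have "b i < b j" using Suc by simp
    moreover have "b j < b (Suc j)" using b_less[of j] Suc.prems by simp
    ultimately show ?thesis by simp
  qed
qed simp

lemma b_mono: "1 \<le> i \<Longrightarrow> i \<le> j \<Longrightarrow> j \<le> k + 1 \<Longrightarrow> b i \<le> b j"
  using b_strict[of i j] by (cases "i = j") auto

text \<open>
  If \<open>(i - 1, b i)\<close> were missing, some crossing \<open>C\<close> would block it. Let \<open>m\<close> be the first row from \<open>i\<close> on
  without a pair of \<open>C\<close>. Moving the pairs of \<open>C\<close> in the rows \<open>i - 1, \<dots>, m - 1\<close> down by one row, to
  the pairs \<open>(i, b i), \<dots>, (m, b m)\<close>, gives a forbidden crossing.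
\<close>

lemma left_of_greedy:
  assumes i: "1 \<le> i" "i \<le> k"
  shows "(i - 1, b i) \<in> F"
proof (rule ccontr)
  assume nF: "(i - 1, b i) \<notin> F"
  have tN: "b i < N" using pairs b_mem i by blast
  have ti: "k + i \<le> b i" using b_ge i by blast
  obtain C where C: "C \<subseteq> insert (i - 1, b i) F" "(i - 1, b i) \<in> C" "index_crossing (k + 1) C"
    using blocking_crossing[OF _ tN nF] ti i by (metis add_leD1 diff_less less_le_trans le_trans less_one linorder_not_less)
  have CF: "x \<in> F" if "x \<in> C" "x \<noteq> (i - 1, b i)" for x
    using C(1) that by blast
  have Cint: "interleave x y" if "x \<in> C" "y \<in> C" "x \<noteq> y" for x y
    using C(3) that by (auto simp: index_crossing_def pairwise_def)
  have Cord: "p < q" "q < N" if "(p, q) \<in> C" for p q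
    using C(1) that pairs ti tN i by fastforce+
  have long: "p + k < q" if "(p, q) \<in> C" for p q
    using index_crossing_long[OF C(3) that] Cord[OF that] by blast
  define m where "m = (LEAST m. i \<le> m \<and> (\<forall>q. (m, q) \<notin> C))"
  \<comment> \<open>Row \<open>N\<close> lies beyond every pair, so a row without a pair of
    \<open>C\<close> exists.\<close>
  have exm: "i \<le> N \<and> (\<forall>q. (N, q) \<notin> C)"
    using Cord ti tN by fastforce
  have m: "i \<le> m" "\<And>q. (m, q) \<notin> C"
    using LeastI[of "\<lambda>m. i \<le> m \<and> (\<forall>q. (m, q) \<notin> C)", OF exm] unfolding m_def by auto
  have below_m: "\<exists>q. (r, q) \<in> C" if "i \<le> r" "r < m" for r
    using not_less_Least[of r "\<lambda>m. i \<le> m \<and> (\<forall>q. (m, q) \<notin> C)"] that unfolding m_def by auto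
  \<comment> \<open>A pair of \<open>C\<close> in row \<open>r\<close> ends after
    \<open>b r\<close>: for \<open>r = i\<close> because it interleaves with
    \<open>(i - 1, b i)\<close>, later because it interleaves with the pair of row
    \<open>r - 1\<close>, which ends at \<open>b r\<close> or beyond. The greedy choice
    \<open>b_last\<close> then pushes it to \<open>b (r + 1)\<close>.\<close>
  have right: "b (r + 1) \<le> q" if "i \<le> r" "r < m" "r \<le> k" "(r, q) \<in> C" for r q
    using that
  proof (induction r arbitrary: q rule: nat_less_induct)
    case (1 r)
    have "b r < q"
    proof (cases "r = i")
      case True
      then have "(i - 1, b i) \<noteq> (r, q)" using i by auto
      then show ?thesis
        using Cint[OF C(2) 1(5)] True ti by (auto simp: interleave_def)
    next
      case False
      then have r: "i \<le> r - 1" "r - 1 < r" "r - 1 < m" "r - 1 \<le> k" "r - 1 + 1 = r"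
        using 1 i by auto
      then obtain q' where q': "(r - 1, q') \<in> C"
        using below_m[of "r - 1"] by blast
      then have "b r \<le> q'"
        using 1(1) r by metis
      moreover have "k + r \<le> b r" using b_ge 1 i by simp
      moreover have "interleave (r - 1, q') (r, q)"
        using Cint[OF q' 1(5)] r by auto
      ultimately show ?thesis using r by (auto simp: interleave_def)
    qed
    moreover have "(r, q) \<in> F"
      using CF[OF 1(5)] 1(2) i by fastforce
    ultimately show ?case
      using b_last[of r q] 1 i by force
  qed
  \<comment> \<open>Otherwise \<open>C\<close> has a pair in row \<open>k\<close>, whose column
    would be at least \<open>b (k + 1) = N\<close>.\<close>
  have mk: "m \<le> k"
  proof (rule ccontr)
    assume "\<not> m \<le> k"
    then obtain q where "(k, q) \<in> C" using below_m[of k] i by auto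
    then show False
      using right[of k q] Cord[of k q] b_end \<open>\<not> m \<le> k\<close> i by auto
  qed
  define g where "g = (\<lambda>x. if i - 1 \<le> fst x \<and> fst x < m then (fst x + 1, b (fst x + 1)) else x)"
  \<comment> \<open>An unmoved pair \<open>(c, d)\<close> starts either after row \<open>m\<close>
    or before row \<open>i - 1\<close>. In the first case \<open>d\<close> exceeds the new column
    because it exceeds the old one, or \<open>b i\<close> if \<open>p = i - 1\<close>. In the second
    case \<open>d\<close> stays below \<open>b i\<close>, and the length of \<open>(c, d)\<close>
    puts \<open>d\<close> beyond row \<open>k\<close>.\<close>
  have moved: "interleave (g x) (g y)"
    if xy: "x \<in> C" "y \<in> C" "i - 1 \<le> fst x" "fst x < m" "\<not> (i - 1 \<le> fst y \<and> fst y < m)" for x y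
  proof -
    obtain p q where x: "x = (p, q)" by (cases x)
    obtain c d where y: "y = (c, d)" by (cases y)
    have p: "i - 1 \<le> p" "p < m" using xy x by auto
    have ne: "x \<noteq> y" using xy by auto
    have "c \<noteq> m" using m(2) xy y by auto
    have yt: "interleave y (i - 1, b i)"
      using Cint[OF xy(2) C(2)] xy(5) m(1) i by (cases "c = i - 1") (auto simp: y)
    have bp: "b i \<le> b (p + 1)" using b_mono[of i "p + 1"] p i mk by auto
    have "interleave (p + 1, b (p + 1)) (c, d)"
    proof (cases "i - 1 < c")
      case True
      then have c: "m < c" "c < b i" "b i < d"
        using yt xy(5) \<open>c \<noteq> m\<close> by (auto simp: y interleave_def)
      have "b (p + 1) < d"
      proof (cases "p = i - 1")
        case True
        then show ?thesis using c i by simp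
      next
        case False
        then have "b (p + 1) \<le> q"
          using right[of p q] p mk xy x by auto
        then show ?thesis
          using Cint[OF xy(1,2) ne] x y c p by (auto simp: interleave_def)
      qed
      then show ?thesis using c p bp by (auto simp: interleave_def)
    next
      case False
      then have "c < i - 1" "d < b i"
        using yt by (auto simp: y interleave_def)
      moreover have "c + k < d" using long xy y by auto
      ultimately show ?thesis
        using p mk bp by (auto simp: interleave_def)
    qed
    then show ?thesis using xy x y by (auto simp: g_def)
  qed
  have sym: "interleave x y \<longleftrightarrow> interleave y x" for x y
    by (auto simp: interleave_def)
  have "interleave (g x) (g y)" if xy: "x \<in> C" "y \<in> C" "x \<noteq> y" for x y
  proof (cases "i - 1 \<le> fst x \<and> fst x < m"; cases "i - 1 \<le> fst y \<and> fst y < m")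
    assume x: "i - 1 \<le> fst x \<and> fst x < m" and y: "i - 1 \<le> fst y \<and> fst y < m"
    have up: "interleave (p + 1, b (p + 1)) (p' + 1, b (p' + 1))"
      if "i - 1 \<le> p" "p < p'" "p' < m" for p p'
      using that b_strict[of "p + 1" "p' + 1"] b_ge[of "p + 1"] mk i
      by (auto simp: interleave_def)
    have "fst x \<noteq> fst y" using interleave_distinct Cint xy by blast
    then show ?thesis
      using up[of "fst x" "fst y"] up[of "fst y" "fst x"] x y sym by (auto simp: g_def neq_iff)
  next
    assume "\<not> (i - 1 \<le> fst x \<and> fst x < m)" "\<not> (i - 1 \<le> fst y \<and> fst y < m)"
    then show ?thesis using Cint[OF xy] by (auto simp: g_def)
  qed (use moved xy sym in blast)+
  then have "index_crossing (k + 1) (g ` C)"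
    using index_crossing_image[of C g] C(3) by (auto simp: index_crossing_def)
  moreover have "g ` C \<subseteq> F"
  proof
    fix z assume "z \<in> g ` C"
    then obtain p q where "(p, q) \<in> C" "z = g (p, q)" by auto
    then show "z \<in> F"
      using CF[of "(p, q)"] b_mem[of "p + 1"] mk i m(1)
      by (cases "p = i - 1") (auto simp: g_def)
  qed
  ultimately show False using free by blast
qed

text \<open>A pair strictly inside the angle at row \<open>i\<close> would fit between
  \<open>(j, b (j + 1))\<close> for the rows \<open>j < i\<close> and \<open>(j, b j)\<close> for
  the rows \<open>j > i\<close>. These are \<open>k + 1\<close> pairs with increasing columns, all
  beyond \<open>k\<close>, hence a forbidden crossing.\<close>

lemma no_bisector:
  assumes t: "(i, t) \<in> F" "i \<le> k" "k < t"
  shows "1 \<le> i \<and> t \<le> b i \<or> i < k \<and> b (i + 1) \<le> t"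
proof (rule ccontr)
  assume neg: "\<not> ?thesis"
  define g where "g = (\<lambda>j. (j, if j < i then b (j + 1) else if j = i then t else b j))"
  have tN: "t < N" using pairs t by blast
  have up: "interleave (g j) (g l)" if "j < l" "l \<le> k" for j l
  proof -
    have "k < snd (g j)" using b_ge[of j] b_ge[of "j + 1"] that t by (auto simp: g_def)
    moreover have "snd (g j) < snd (g l)"
    proof -
      have "b (j + 1) < b (l + 1)" "1 \<le> j \<Longrightarrow> b j < b l"
        using b_strict that by auto
      moreover have "b (j + 1) < t" if "j < i"
        using b_mono[of "j + 1" i] that neg t by auto
      moreover have "t < b l" if "i < l" "l \<le> k"
        using b_mono[of "i + 1" l] that neg by auto
      moreover have "b (j + 1) \<le> b l" using b_mono[of "j + 1" l] that by auto
      ultimately show ?thesis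
        using that
        by (cases j i rule: linorder_cases; cases l i rule: linorder_cases) (auto simp: g_def)
    qed
    ultimately show ?thesis using that by (auto simp: interleave_def g_def)
  qed
  have "index_crossing (card {..k}) (g ` {..k})"
  proof (rule index_crossing_image)
    fix x y assume "x \<in> {..k}" "y \<in> {..k}" "x \<noteq> y"
    then show "interleave (g x) (g y)"
      using up[of x y] up[of y x] by (auto simp: interleave_def neq_iff)
  qed simp
  moreover have "g ` {..k} \<subseteq> F"
    using left_of_greedy b_mem t by (force simp: g_def)
  ultimately show False using free by simp
qed

end

text \<open>The descending choice is run as an ascending recursion on \<open>j = k + 1 - i\<close>.
  The invariant \<open>2 * k + 1 - j \<le> B j\<close> leaves room for
  \<open>(k - j, 2 * k - j)\<close>, a pair of length \<open>k\<close> and thus present, so every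
  maximum is over a nonempty set.\<close>

lemma (in index_triangulation) greedy_columns_exist:
  assumes N: "2 * k + 1 \<le> N"
  shows "\<exists>b. greedy_columns k N F b"
proof -
  define B where "B = rec_nat N (\<lambda>j c. Max {t. t < c \<and> (k - j, t) \<in> F})"
  define b where "b = (\<lambda>i. B (k + 1 - i))"
  have B_Suc: "B (Suc j) = Max {t. t < B j \<and> (k - j, t) \<in> F}" for j
    by (simp add: B_def)
  have "B j \<le> N \<and> 2 * k + 1 - j \<le> B j \<and>
      (0 < j \<longrightarrow> B j \<in> {t. t < B (j - 1) \<and> (k + 1 - j, t) \<in> F} \<and>
      (\<forall>t\<in>{t. t < B (j - 1) \<and> (k + 1 - j, t) \<in> F}. t \<le> B j))" if "j \<le> k" for j
    using that
  proof (induction j)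
    case 0
    then show ?case using N by (simp add: B_def)
  next
    case (Suc j)
    let ?S = "{t. t < B j \<and> (k - j, t) \<in> F}"
    have fin: "finite ?S" by simp
    have "(k - j, 2 * k - j) \<in> F"
      using short_pair[of "k - j" "2 * k - j"] Suc.prems N by auto
    moreover have "2 * k - j < B j" using Suc by auto
    ultimately have mem: "2 * k - j \<in> ?S" by blast
    then have "Max ?S \<in> ?S" using Max_in[OF fin] by blast
    moreover have "t \<le> Max ?S" if "t \<in> ?S" for t using Max_ge[OF fin that] .
    ultimately show ?case using Suc mem by (fastforce simp: B_Suc)
  qed
  note * = this
  have "greedy_columns k N F b"
  proof unfold_locales
    show "b (k + 1) = N" by (simp add: b_def B_def)
    fix i assume i: "1 \<le> i" "i \<le> k"
    then have k: "k + 1 - i \<le> k" "0 < k + 1 - i" "k + 1 - (k + 1 - i) = i"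
      "k + 1 - (i + 1) = k + 1 - i - 1"
      by auto
    show "(i, b i) \<in> F" "k + i \<le> b i" "b i < b (i + 1)"
      using *[OF k(1)] k i unfolding b_def by auto
    show "(i, t) \<notin> F" if "b i < t" "t < b (i + 1)" for t
      using *[OF k(1)] k i that unfolding b_def by auto
  qed
  then show ?thesis by blast
qed

section \<open>Points on the circle\<close>

lemma ang_nonneg: "0 \<le> ang u v" and ang_less: "ang u v < 2 * pi"
  using Arg2pi[of "v / u"] by (auto simp: ang_def)

lemma ang_cis:
  assumes "u \<in> sphere 0 1" "v \<in> sphere 0 1"
  shows "v = u * cis (ang u v)"
proof -
  have "norm (v / u) = 1" "u \<noteq> 0" using assms by (auto simp: norm_divide)
  then have "cis (ang u v) = v / u"
    using complex_norm_eq_1_exp[of "v / u"] by (simp add: ang_def cis_conv_exp)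
  then show ?thesis using \<open>u \<noteq> 0\<close> by simp
qed

lemma ang_eqI:
  assumes "u \<in> sphere 0 1" "v = u * cis a" "0 \<le> a" "a < 2 * pi"
  shows "ang u v = a"
proof -
  have "u \<noteq> 0" using assms by auto
  then show ?thesis
    using assms by (auto simp: ang_def cis_conv_exp intro!: Arg2pi_unique[of 1])
qed

lemma ang_self: "u \<in> sphere 0 1 \<Longrightarrow> ang u u = 0"
  by (rule ang_eqI) auto

text \<open>Reduces all angle comparisons to one base point; a full turn is added when
  \<open>y\<close> comes before \<open>x\<close> as seen from \<open>p\<close>.\<close>

lemma ang_change_base:
  assumes "p \<in> sphere 0 1" "x \<in> sphere 0 1" "y \<in> sphere 0 1"
  shows "ang x y = (if ang p x \<le> ang p y then ang p y - ang p x else ang p y - ang p x + 2 * pi)"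
proof (rule ang_eqI)
  have "x * cis (ang p y - ang p x) = p * (cis (ang p x) * cis (ang p y - ang p x))"
    using ang_cis[OF assms(1,2)] by (metis mult.assoc)
  also have "\<dots> = y"
    using ang_cis[OF assms(1,3)] by (simp add: cis_mult)
  finally have *: "x * cis (ang p y - ang p x) = y" .
  have "cis (ang p y - ang p x + 2 * pi) = cis (ang p y - ang p x)"
    by (simp add: cis.code)
  then show "y = x * cis (if ang p x \<le> ang p y then ang p y - ang p x else ang p y - ang p x + 2 * pi)"
    using * by simp
qed (use assms ang_nonneg[of p y] ang_nonneg[of p x] ang_less[of p x] ang_less[of p y] in auto)

text \<open>Twice the signed area of the triangle \<open>p q r\<close>, positive when the triangle
  is traversed counterclockwise.\<close>

definition orient :: "complex \<Rightarrow> complex \<Rightarrow> complex \<Rightarrow> real" where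
  "orient p q r = Im (cnj (q - p) * (r - p))"

text \<open>Up to a rotation the area is \<open>4 * sin x * sin y * sin (x + y)\<close>, where
  \<open>x\<close>, \<open>y\<close> and \<open>x + y\<close> are half the central angles and lie
  strictly between \<open>0\<close> and \<open>pi\<close>.\<close>

lemma orient_pos:
  assumes "z \<in> sphere 0 1" "\<alpha> < \<beta>" "\<beta> < \<gamma>" "\<gamma> < \<alpha> + 2 * pi"
  shows "0 < orient (z * cis \<alpha>) (z * cis \<beta>) (z * cis \<gamma>)"
proof -
  define x where "x = (\<beta> - \<alpha>) / 2"
  define y where "y = (\<gamma> - \<beta>) / 2"
  have zz: "cnj z * z = 1"
    using assms(1) by (simp add: complex_norm_square[symmetric] mult.commute)
  have "cnj (z * cis \<beta> - z * cis \<alpha>) * (z * cis \<gamma> - z * cis \<alpha>) =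
      (cnj z * z) * (cnj (cis \<beta> - cis \<alpha>) * (cis \<gamma> - cis \<alpha>))"
    by (simp add: algebra_simps)
  then have "orient (z * cis \<alpha>) (z * cis \<beta>) (z * cis \<gamma>) =
      Im (cnj (cis \<beta> - cis \<alpha>) * (cis \<gamma> - cis \<alpha>))"
    unfolding orient_def zz by simp
  also have "\<dots> = sin (\<gamma> - \<beta>) + sin (\<beta> - \<alpha>) - sin (\<gamma> - \<alpha>)"
    by (simp add: sin_diff algebra_simps)
  also have "\<dots> = sin (2 * y) + sin (2 * x) - sin (2 * x + 2 * y)"
  proof -
    have "\<gamma> - \<beta> = 2 * y" "\<beta> - \<alpha> = 2 * x" "\<gamma> - \<alpha> = 2 * x + 2 * y"
      by (auto simp: x_def y_def field_simps)
    then show ?thesis by presburger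
  qed
  also have "\<dots> = 2 * sin y * cos y * (1 - cos (2 * x)) + 2 * sin x * cos x * (1 - cos (2 * y))"
    by (simp only: sin_add sin_double) algebra
  also have "\<dots> = 4 * sin x * sin y * sin (x + y)"
    by (simp only: cos_double_sin sin_add) algebra
  also have "\<dots> > 0"
    using assms by (intro mult_pos_pos sin_gt_zero) (auto simp: x_def y_def field_simps)
  finally show ?thesis .
qed

lemma orient_rotate: "orient q r p = orient p q r"
  by (auto simp: orient_def algebra_simps)

lemma orient_self: "orient p q p = 0" "orient p q q = 0"
  by (auto simp: orient_def algebra_simps)

lemma orient_affine: "orient p q ((1 - u) *\<^sub>R r + u *\<^sub>R t) = (1 - u) * orient p q r + u * orient p q t"
  by (simp add: orient_def algebra_simps)

text \<open>
  The affine dependency of four points with the orientations as coefficients exhibits the common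
  point of the diagonals.
\<close>

lemma diagonals_meet:
  assumes "0 < orient p q r" "0 < orient p q t" "0 < orient p r t" "0 < orient q r t"
  shows "open_segment p r \<inter> open_segment q t \<noteq> {}"
proof -
  \<comment> \<open>The coefficients on the two sides of the dependency have the same sum
    \<open>S\<close>, twice the area of the quadrilateral; dividing by it gives two convex
    combinations.\<close>
  define S where "S = orient q r t + orient p q t"
  have S: "0 < S" "orient p r t + orient p q r = S"
    using assms by (auto simp: S_def orient_def algebra_simps)
  define u where "u = orient p q t / S"
  define w where "w = orient p q r / S"
  have u: "0 < u" "u < 1" "1 - u = orient q r t / S"
    using assms S by (auto simp: u_def S_def field_simps)
  have w: "0 < w" "w < 1" "1 - w = orient p r t / S"
    using assms S by (auto simp: w_def field_simps)
  have dep: "orient q r t *\<^sub>R p + orient p q t *\<^sub>R r = orient p r t *\<^sub>R q + orient p q r *\<^sub>R t"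
    by (rule complex_eqI) (auto simp: orient_def algebra_simps)
  have "(1 - u) *\<^sub>R p + u *\<^sub>R r = (1 / S) *\<^sub>R (orient q r t *\<^sub>R p + orient p q t *\<^sub>R r)"
    unfolding u(3) by (simp add: u_def scaleR_add_right)
  also have "\<dots> = (1 - w) *\<^sub>R q + w *\<^sub>R t"
    unfolding w(3) dep by (simp add: w_def scaleR_add_right)
  finally have eq: "(1 - u) *\<^sub>R p + u *\<^sub>R r = (1 - w) *\<^sub>R q + w *\<^sub>R t" .
  have "p \<noteq> r" "q \<noteq> t" using assms by (auto simp: orient_def)
  then have "(1 - u) *\<^sub>R p + u *\<^sub>R r \<in> open_segment p r" "(1 - w) *\<^sub>R q + w *\<^sub>R t \<in> open_segment q t"
    using u(1,2) w(1,2) by (auto simp: in_segment)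
  then show ?thesis unfolding eq by blast
qed

text \<open>The signed area over \<open>p q\<close> is affine along the segment from
  \<open>r\<close> to \<open>t\<close>. It is positive in the interior of that segment but vanishes
  on the line through \<open>p\<close> and \<open>q\<close>.\<close>

lemma same_side_disjoint:
  assumes "0 \<le> orient p q r" "0 \<le> orient p q t" "0 < orient p q r \<or> 0 < orient p q t"
  shows "open_segment p q \<inter> open_segment r t = {}"
proof (rule ccontr)
  assume "\<not> ?thesis"
  then obtain x where "x \<in> open_segment p q" "x \<in> open_segment r t" by blast
  then obtain u w where u: "x = (1 - u) *\<^sub>R p + u *\<^sub>R q" and
      w: "0 < w" "w < 1" "x = (1 - w) *\<^sub>R r + w *\<^sub>R t"
    unfolding in_segment by blast
  have "orient p q x = 0" unfolding u orient_affine by (simp add: orient_self)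
  moreover have "0 < (1 - w) * orient p q r + w * orient p q t"
    using assms w by (auto intro: add_pos_nonneg add_nonneg_pos)
  ultimately show False unfolding w(3) orient_affine by simp
qed

section \<open>Counterclockwise enumerations: cyclic order as order of indices\<close>

locale ccw_enum =
  fixes v :: "nat \<Rightarrow> complex" and N :: nat
  assumes on_circle: "\<And>j. j < N \<Longrightarrow> v j \<in> sphere 0 1"
    and ang_strict: "\<And>i j. i < j \<Longrightarrow> j < N \<Longrightarrow> ang (v 0) (v i) < ang (v 0) (v j)"
begin

abbreviation \<theta> :: "nat \<Rightarrow> real" where
  "\<theta> j \<equiv> ang (v 0) (v j)"

lemma \<theta>_less_iff: "i < N \<Longrightarrow> j < N \<Longrightarrow> \<theta> i < \<theta> j \<longleftrightarrow> i < j"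
  using ang_strict[of i j] ang_strict[of j i] by (cases i j rule: linorder_cases) auto

lemma \<theta>_le_iff: "i < N \<Longrightarrow> j < N \<Longrightarrow> \<theta> i \<le> \<theta> j \<longleftrightarrow> i \<le> j"
  using \<theta>_less_iff[of j i] by (auto simp: not_less[symmetric])

lemma v_eq_iff: "i < N \<Longrightarrow> j < N \<Longrightarrow> v i = v j \<longleftrightarrow> i = j"
  using \<theta>_less_iff[of i j] \<theta>_less_iff[of j i] by (metis less_irrefl linorder_neqE_nat)

lemma inj_v: "inj_on v {..<N}"
  using v_eq_iff by (auto intro: inj_onI)

lemma ang_index:
  assumes "a < N" "b < N"
  shows "ang (v a) (v b) = (if a \<le> b then \<theta> b - \<theta> a else \<theta> b - \<theta> a + 2 * pi)"
  using ang_change_base[of "v 0" "v a" "v b"] on_circle[of 0] on_circle[OF assms(1)]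
    on_circle[OF assms(2)] \<theta>_le_iff[OF assms] assms by auto

lemma arc_oc_iff:
  assumes "a \<le> c" "c < N" "b < N"
  shows "v b \<in> arc_oc (v a) (v c) \<longleftrightarrow> a < b \<and> b \<le> c"
  using ang_index[of a b] ang_index[of a c] \<theta>_less_iff[of a b] \<theta>_le_iff[of b c]
    on_circle[of b] ang_nonneg[of "v 0" "v b"] ang_less[of "v 0" "v c"] assms
  by (auto simp: arc_oc_def not_le)

text \<open>The arc runs past the last index; under \<open>a \<le> b\<close> its wrapped part, the
  indices below \<open>a\<close>, is out of reach.\<close>

lemma arc_co_iff:
  assumes "a < c" "c < N" "b < N" "a \<le> b"
  shows "v b \<in> arc_co (v c) (v a) \<longleftrightarrow> c \<le> b"
  using ang_index[of c b] ang_index[of c a] \<theta>_le_iff[of a b]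
    on_circle[of b] ang_nonneg[of "v 0" "v a"] ang_less[of "v 0" "v b"] assms
  by (auto simp: arc_co_def not_le)

lemma orient_index:
  assumes "a < b" "b < c" "c < N"
  shows "0 < orient (v a) (v b) (v c)"
proof -
  have *: "v j = v 0 * cis (\<theta> j)" if "j < N" for j
    using ang_cis[of "v 0" "v j"] on_circle that by simp
  have "\<theta> a < \<theta> b" "\<theta> b < \<theta> c" using \<theta>_less_iff assms by auto
  moreover have "\<theta> c < \<theta> a + 2 * pi"
    using ang_less[of "v 0" "v c"] ang_nonneg[of "v 0" "v a"] by simp
  ultimately have "0 < orient (v 0 * cis (\<theta> a)) (v 0 * cis (\<theta> b)) (v 0 * cis (\<theta> c))"
    using orient_pos on_circle[of 0] assms by simp
  then show ?thesis using *[of a] *[of b] *[of c] assms by simp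
qed

text \<open>Interleaving pairs are the diagonals of a convex quadrilateral. Otherwise both ends of
  one chord lie on the same closed side of the line through the other, and not both on that
  line.\<close>

lemma crosses_index:
  assumes ab: "a < b" "b < N" and cd: "c < d" "d < N"
  shows "crosses {v a, v b} {v c, v d} \<longleftrightarrow> interleave (a, b) (c, d)"
proof
  let ?meet = "open_segment (v a) (v b) \<inter> open_segment (v c) (v d) \<noteq> {}"
  {
    assume "crosses {v a, v b} {v c, v d}"
    then have meet: ?meet and ne: "{v a, v b} \<noteq> {v c, v d}"
      by (auto simp: crosses_def doubleton_eq_iff open_segment_commute)
    have ne': "(a, b) \<noteq> (c, d)" using ne by auto
    show "interleave (a, b) (c, d)"
    proof (rule ccontr)
      assume neg: "\<not> ?thesis"
      have inside: "0 \<le> orient (v b) (v a) (v w)" "a < w \<Longrightarrow> w < b \<Longrightarrow> 0 < orient (v b) (v a) (v w)"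
        if "a \<le> w" "w \<le> b" for w
        using that orient_index[of a w b] ab orient_self orient_rotate
        by (metis order.order_iff_strict)+
      have outside: "0 \<le> orient (v a) (v b) (v w)" "w < a \<or> b < w \<Longrightarrow> 0 < orient (v a) (v b) (v w)"
        if "w \<le> a \<or> b \<le> w" "w < N" for w
        using that orient_index[of w a b] orient_index[of a b w] ab orient_self orient_rotate
        by (metis order.order_iff_strict)+
      have "a \<le> c \<and> d \<le> b \<or> (c \<le> a \<or> b \<le> c) \<and> (d \<le> a \<or> b \<le> d)"
        using neg ab cd by (auto simp: interleave_def)
      then show False
      proof
        assume "a \<le> c \<and> d \<le> b"
        then have "open_segment (v b) (v a) \<inter> open_segment (v c) (v d) = {}"
          using same_side_disjoint[of "v b" "v a" "v c" "v d"] inside[of c] inside[of d] cd ne' by force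
        then show False using meet by (simp add: open_segment_commute)
      next
        assume "(c \<le> a \<or> b \<le> c) \<and> (d \<le> a \<or> b \<le> d)"
        moreover have "(c < a \<or> b < c) \<or> (d < a \<or> b < d)"
          if "(c \<le> a \<or> b \<le> c) \<and> (d \<le> a \<or> b \<le> d)"
          using that ab cd ne' by auto
        ultimately show False
          using same_side_disjoint[of "v a" "v b" "v c" "v d"] outside[of c] outside[of d] cd meet
          by force
      qed
    qed
  }
  assume i: "interleave (a, b) (c, d)"
  then have ?meet
  proof (unfold interleave_def, elim disjE)
    assume "fst (a, b) < fst (c, d) \<and> fst (c, d) < snd (a, b) \<and> snd (a, b) < snd (c, d)"
    then show ?thesis
      using diagonals_meet[of "v a" "v c" "v b" "v d"] orient_index cd by auto
  next
    assume "fst (c, d) < fst (a, b) \<and> fst (a, b) < snd (c, d) \<and> snd (c, d) < snd (a, b)"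
    then show ?thesis
      using diagonals_meet[of "v c" "v a" "v d" "v b"] orient_index ab by auto
  qed
  moreover have "{v a, v b} \<noteq> {v c, v d}"
    using interleave_distinct[OF i] ab cd by (auto simp: doubleton_eq_iff v_eq_iff)
  ultimately show "crosses {v a, v b} {v c, v d}"
    unfolding crosses_def by blast
qed

lemma succ_index:
  assumes "2 \<le> N" "a < N"
  shows "ccw_succ (v ` {..<N}) (v a) = v ((a + 1) mod N)"
proof -
  let ?S = "v ` {..<N} - {v a}"
  let ?n = "(a + 1) mod N"
  have n: "?n < N" "?n \<noteq> a" "?n = (if a + 1 < N then a + 1 else 0)"
    using assms by (auto simp: mod_Suc)
  have nS: "v ?n \<in> ?S" using n assms v_eq_iff by auto
  have fin: "finite ?S" by simp
  have S: "arg_min_on (ang (v a)) ?S \<in> ?S"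
    "\<not> ang (v a) (v ?n) < ang (v a) (arg_min_on (ang (v a)) ?S)"
    using arg_min_if_finite[OF fin, of "ang (v a)"] nS by blast+
  obtain c where c: "c < N" "c \<noteq> a" "arg_min_on (ang (v a)) ?S = v c"
    using S(1) by auto
  have "ang (v a) (v ?n) < ang (v a) (v c)" if "c \<noteq> ?n"
    using that ang_index[of a c] ang_index[of a ?n] \<theta>_less_iff[of ?n c] n c assms
      ang_nonneg[of "v 0" "v c"] ang_less[of "v 0" "v ?n"]
    by (auto split: if_splits)
  then show ?thesis
    using S(2) c by (auto simp: ccw_succ_def)
qed

lemma shift_index:
  assumes "2 \<le> N" "a < N"
  shows "shift (v ` {..<N}) (v a) j = v ((a + j) mod N)"
proof (induction j)
  case 0
  then show ?case using assms by (simp add: shift_def)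
next
  case (Suc j)
  have "shift (v ` {..<N}) (v a) (Suc j) = ccw_succ (v ` {..<N}) (v ((a + j) mod N))"
    using Suc by (simp add: shift_def)
  also have "\<dots> = v (((a + j) mod N + 1) mod N)"
    using succ_index assms by simp
  finally show ?case by (simp add: mod_Suc_eq)
qed

text \<open>The base point moves from \<open>v 0\<close> to \<open>v (\<sigma> 0)\<close>; as no
  selected index precedes \<open>\<sigma> 0\<close>, angles from there are plain
  differences.\<close>

lemma ccw_enum_sub:
  assumes "\<And>i j. i < j \<Longrightarrow> j < m \<Longrightarrow> \<sigma> i < \<sigma> j" "\<And>j. j < m \<Longrightarrow> \<sigma> j < N"
  shows "ccw_enum (\<lambda>j. v (\<sigma> j)) m"
proof
  fix i j assume ij: "i < j" "j < m"
  have "\<sigma> 0 \<le> \<sigma> i" using assms(1)[of 0 i] ij by (cases "i = 0") auto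
  moreover have "\<sigma> i < \<sigma> j" "\<sigma> j < N" using assms ij by auto
  ultimately show "ang (v (\<sigma> 0)) (v (\<sigma> i)) < ang (v (\<sigma> 0)) (v (\<sigma> j))"
    using ang_index[of "\<sigma> 0" "\<sigma> i"] ang_index[of "\<sigma> 0" "\<sigma> j"] \<theta>_less_iff by auto
qed (use assms on_circle in auto)

text \<open>Turns the vertex set of a star, or of a crossing together with \<open>s\<^sub>0\<close>,
  into an increasing sequence of indices; membership of \<open>v 0\<close> fixes where the sequence
  starts.\<close>

lemma subset_enum:
  assumes W: "W \<subseteq> v ` {..<N}" "v 0 \<in> W" "card W = m"
  obtains \<sigma> where "\<sigma> 0 = 0" "\<And>i j. i < j \<Longrightarrow> j < m \<Longrightarrow> \<sigma> i < \<sigma> j" "\<And>j. j < m \<Longrightarrow> \<sigma> j < N"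
    "W = (\<lambda>j. v (\<sigma> j)) ` {..<m}"
proof -
  define I where "I = {j. j < N \<and> v j \<in> W}"
  have WI: "W = v ` I" using W by (auto simp: I_def)
  have "inj_on v I" by (rule inj_on_subset[OF inj_v]) (auto simp: I_def)
  then have cI: "card I = m" using WI W(3) by (simp add: card_image)
  have "finite I" by (simp add: I_def)
  then obtain \<sigma> where s: "bij_betw \<sigma> {..<card I} I" "strict_mono_on {..<card I} \<sigma>"
    using ex_bij_betw_strict_mono_card by blast
  have "0 \<in> I"
  proof -
    obtain j where "j < N" "v 0 = v j" using W by auto
    then show ?thesis using W by (auto simp: I_def)
  qed
  then obtain j where j: "j < m" "\<sigma> j = 0" using s(1) cI by (force simp: bij_betw_def)
  have less: "\<sigma> i < \<sigma> j" if "i < j" "j < m" for i j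
    using s(2) cI that by (auto simp: strict_mono_on_def)
  have "\<sigma> 0 = 0" using less[of 0 j] j by (cases "j = 0") auto
  moreover have "\<sigma> j < N" if "j < m" for j
    using s(1) cI that by (auto simp: bij_betw_def I_def)
  moreover have "W = (\<lambda>j. v (\<sigma> j)) ` {..<m}"
    using s(1) cI WI by (auto simp: bij_betw_def image_image[symmetric])
  ultimately show ?thesis using less that by blast
qed

end

text \<open>Distinct points of the circle have distinct angles from \<open>p\<close>, so sorting the
  angles sorts the vertices.\<close>

lemma ccw_enum_exists:
  assumes "finite V" "V \<subseteq> sphere 0 1" "p \<in> V" "card V = N"
  obtains v where "ccw_enum v N" "v 0 = p" "V = v ` {..<N}"
proof -
  define A where "A = ang p ` V"
  have inj: "inj_on (ang p) V"
  proof (rule inj_onI)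
    fix x y assume "x \<in> V" "y \<in> V" "ang p x = ang p y"
    then show "x = y" using ang_cis[of p x] ang_cis[of p y] assms(2,3) by (metis subsetD)
  qed
  have cA: "card A = N" using inj assms(4) by (simp add: A_def card_image)
  have fA: "finite A" using assms by (simp add: A_def)
  define xs where "xs = sorted_list_of_set A"
  have xs: "length xs = N" "set xs = A" "sorted_wrt (<) xs"
    using fA cA by (auto simp: xs_def)
  define v where "v = (\<lambda>j. inv_into V (ang p) (xs ! j))"
  have v: "v j \<in> V" "ang p (v j) = xs ! j" if "j < N" for j
    using that xs nth_mem[of j xs] unfolding v_def A_def
    by (auto intro: inv_into_into f_inv_into_f)
  have less: "ang p (v i) < ang p (v j)" if "i < j" "j < N" for i j
    using that v xs by (auto simp: sorted_wrt_iff_nth_less)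
  have img: "V = v ` {..<N}"
  proof
    show "V \<subseteq> v ` {..<N}"
    proof
      fix x assume x: "x \<in> V"
      then obtain j where "j < N" "xs ! j = ang p x"
        using xs by (metis A_def imageI in_set_conv_nth)
      then show "x \<in> v ` {..<N}"
        using x inj v inj_onD[OF inj] by (metis imageI lessThan_iff)
    qed
  qed (use v in auto)
  have "v 0 = p"
  proof -
    obtain j where j: "j < N" "p = v j" using img assms by auto
    have "ang p p = 0" using ang_self assms by auto
    then have "j = 0"
      using less[of 0 j] ang_nonneg[of p "v 0"] j by (cases "j = 0") auto
    then show ?thesis using j by simp
  qed
  moreover have "ccw_enum v N"
    by unfold_locales (use v assms(2) less \<open>v 0 = p\<close> in blast)+
  ultimately show ?thesis using img that by blast
qed

section \<open>The star of a boundary edge\<close>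

text \<open>A strictly increasing sequence with both ends pinned tightly has consecutive values;
  this identifies the first \<open>k + 1\<close> vertices of a star.\<close>

lemma strict_gap:
  fixes \<rho> :: "nat \<Rightarrow> nat"
  assumes "\<And>i j. i < j \<Longrightarrow> j < m \<Longrightarrow> \<rho> i < \<rho> j" "i \<le> j" "j < m"
  shows "\<rho> i + (j - i) \<le> \<rho> j"
  using assms(2,3)
proof (induction j)
  case (Suc j)
  then show ?case using assms(1)[of j "Suc j"] by (cases "i = Suc j") auto
qed simp

section \<open>Edges and triangulations of the polygon in terms of indices\<close>

context ccw_enum
begin

abbreviation chord :: "nat \<times> nat \<Rightarrow> complex set" where
  "chord x \<equiv> {v (fst x), v (snd x)}"

lemma chord_eq_iff:
  "a < b \<Longrightarrow> b < N \<Longrightarrow> c < d \<Longrightarrow> d < N \<Longrightarrow> {v a, v b} = {v c, v d} \<longleftrightarrow> a = c \<and> b = d"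
  by (auto simp: doubleton_eq_iff v_eq_iff)

lemma edges_index:
  assumes "I \<subseteq> {..<N}"
  shows "f \<in> edges (v ` I) \<longleftrightarrow> (\<exists>a b. a \<in> I \<and> b \<in> I \<and> a < b \<and> f = {v a, v b})"
proof
  assume "f \<in> edges (v ` I)"
  then obtain a b where ab: "a \<in> I" "b \<in> I" "v a \<noteq> v b" "f = {v a, v b}"
    by (auto simp: edges_def)
  then have "a < b \<or> b < a" by (metis linorder_neqE_nat)
  then show "\<exists>a b. a \<in> I \<and> b \<in> I \<and> a < b \<and> f = {v a, v b}"
    using ab by (metis insert_commute)
next
  assume "\<exists>a b. a \<in> I \<and> b \<in> I \<and> a < b \<and> f = {v a, v b}"
  then obtain a b where ab: "a \<in> I" "b \<in> I" "a < b" "f = {v a, v b}" by blast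
  then have "v a \<noteq> v b" using assms v_eq_iff[of a b] by auto
  then show "f \<in> edges (v ` I)" using ab by (auto simp: edges_def)
qed

lemma chord_mem_edges:
  assumes "I \<subseteq> {..<N}" "a < b" "b < N" "{v a, v b} \<in> edges (v ` I)"
  shows "a \<in> I \<and> b \<in> I"
proof -
  obtain c d where "c \<in> I" "d \<in> I" "c < d" "{v a, v b} = {v c, v d}"
    using edges_index[OF assms(1)] assms(4) by blast
  then show ?thesis using chord_eq_iff[of a b c d] assms by auto
qed

lemma edge_sets_eqI:
  assumes "A \<subseteq> edges (v ` {..<N})" "B \<subseteq> edges (v ` {..<N})"
    "\<And>a b. a < b \<Longrightarrow> b < N \<Longrightarrow> {v a, v b} \<in> A \<longleftrightarrow> {v a, v b} \<in> B"
  shows "A = B"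
proof (rule set_eqI)
  fix f
  have "f \<in> A \<longleftrightarrow> f \<in> B" if "f \<in> edges (v ` {..<N})"
    using that assms(3) edges_index[of "{..<N}" f] by auto
  then show "f \<in> A \<longleftrightarrow> f \<in> B" using assms(1,2) by blast
qed

lemma crossing_index:
  assumes C: "C \<subseteq> {(a, b). a < b \<and> b < N}"
  shows "crossing l (chord ` C) \<longleftrightarrow> index_crossing l C"
proof -
  have inj: "inj_on chord C"
  proof (rule inj_onI)
    fix x y assume "x \<in> C" "y \<in> C" "chord x = chord y"
    then show "x = y"
      using subsetD[OF C, of x] subsetD[OF C, of y] chord_eq_iff[of "fst x" "snd x" "fst y" "snd y"]
      by (cases x; cases y) auto
  qed
  have "crosses (chord x) (chord y) \<longleftrightarrow> interleave x y" if "x \<in> C" "y \<in> C" for x y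
    using crosses_index[of "fst x" "snd x" "fst y" "snd y"] subsetD[OF C that(1)]
      subsetD[OF C that(2)] by auto
  then have "pairwise crosses (chord ` C) \<longleftrightarrow> pairwise interleave C"
    using inj_on_eq_iff[OF inj] by (simp add: pairwise_def)
  then show ?thesis
    using inj by (simp add: crossing_def index_crossing_def finite_image_iff card_image)
qed

text \<open>The right-hand side mentions the vertex set only, so a star does not depend on the
  vertex at which its listing begins.\<close>

lemma star_as_shift:
  assumes "2 \<le> N"
  shows "{{v j, v ((j + k) mod N)} | j. j < N} = {{x, shift (v ` {..<N}) x k} | x. x \<in> v ` {..<N}}"
proof -
  have "(\<lambda>j. {v j, v ((j + k) mod N)}) ` {..<N} =
      (\<lambda>x. {x, shift (v ` {..<N}) x k}) ` v ` {..<N}"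
    unfolding image_image using shift_index[OF assms] by (intro image_cong) auto
  then show ?thesis unfolding image_def lessThan_iff by blast
qed

definition index_pairs :: "complex set set \<Rightarrow> (nat \<times> nat) set" where
  "index_pairs T = {(a, b). a < b \<and> b < N \<and> {v a, v b} \<in> T}"

lemma chord_index_pairs: "T \<subseteq> edges (v ` {..<N}) \<Longrightarrow> chord ` index_pairs T = T"
proof
  assume T: "T \<subseteq> edges (v ` {..<N})"
  show "T \<subseteq> chord ` index_pairs T"
  proof
    fix f assume f: "f \<in> T"
    then obtain a b where "a < b" "b < N" "f = {v a, v b}"
      using T edges_index[of "{..<N}" f] by auto
    then show "f \<in> chord ` index_pairs T"
      using f by (intro image_eqI[of _ _ "(a, b)"]) (auto simp: index_pairs_def)
  qed
qed (auto simp: index_pairs_def)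

lemma index_triangulation:
  assumes T: "k_triangulation k (v ` {..<N}) T"
  shows "index_triangulation k N (index_pairs T)"
proof
  let ?F = "index_pairs T"
  have T_edges: "T \<subseteq> edges (v ` {..<N})" using T by (simp add: k_triangulation_def)
  show "a < b \<and> b < N" if "(a, b) \<in> ?F" for a b
    using that by (simp add: index_pairs_def)
  show "\<not> index_crossing (k + 1) C" if C: "C \<subseteq> ?F" for C
  proof -
    have "C \<subseteq> {(a, b). a < b \<and> b < N}" "chord ` C \<subseteq> T"
      using C by (auto simp: index_pairs_def)
    moreover have "\<not> crossing (k + 1) E" if "E \<subseteq> T" for E
      using T that by (simp add: k_triangulation_def crossing_free_def)
    ultimately show ?thesis using crossing_index[of C "k + 1"] by blast
  qed
  show "\<exists>C. C \<subseteq> insert (a, b) ?F \<and> index_crossing (k + 1) C"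
    if ab: "a < b" "b < N" "(a, b) \<notin> ?F" for a b
  proof -
    have new: "{v a, v b} \<notin> T" using ab by (simp add: index_pairs_def)
    have "{v a, v b} \<in> edges (v ` {..<N})"
      using edges_index[of "{..<N}" "{v a, v b}"] ab by (metis less_trans lessThan_iff order_refl)
    then have "T \<subset> insert {v a, v b} T" "insert {v a, v b} T \<subseteq> edges (v ` {..<N})"
      using new T_edges by auto
    then have "\<not> crossing_free (k + 1) (insert {v a, v b} T)"
      using T unfolding k_triangulation_def by blast
    then obtain E where E: "E \<subseteq> insert {v a, v b} T" "crossing (k + 1) E"
      by (auto simp: crossing_free_def)
    then have "chord ` index_pairs E = E"
      using chord_index_pairs[of E] \<open>insert {v a, v b} T \<subseteq> edges (v ` {..<N})\<close> by (metis order_trans)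
    then have "index_crossing (k + 1) (index_pairs E)"
      using crossing_index[of "index_pairs E"] E(2) by (auto simp: index_pairs_def)
    moreover have "index_pairs E \<subseteq> insert (a, b) ?F"
      using E(1) ab chord_eq_iff by (auto simp: index_pairs_def)
    ultimately show ?thesis by blast
  qed
qed

end

section \<open>Star frames: a candidate star given by its index sequence\<close>

lemma star_mod:
  assumes "1 \<le> i" "i \<le> k"
  shows "(k + i + k) mod (2 * k + 1) = i - (1::nat)"
proof -
  have "k + i + k = (i - 1) + (2 * k + 1)" using assms by simp
  then have "(k + i + k) mod (2 * k + 1) = (i - 1) mod (2 * k + 1)"
    by (metis mod_add_self2)
  then show ?thesis using assms by simp
qed

text \<open>
  The vertices \<open>s\<^sub>0, \<dots>, s\<^sub>2\<^sub>k\<close> are \<open>v (\<sigma> 0), \<dots>, v (\<sigma> (2 * k))\<close>; the value \<open>\<sigma> (2 * k + 1) = N\<close>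
  stands for a second copy of \<open>s\<^sub>0\<close> at the end of the enumeration.
\<close>

locale star_frame = ccw_enum +
  fixes k :: nat and \<sigma> :: "nat \<Rightarrow> nat"
  assumes k_pos: "1 \<le> k"
    and \<sigma>_less: "\<And>i j. i < j \<Longrightarrow> j \<le> 2 * k + 1 \<Longrightarrow> \<sigma> i < \<sigma> j"
    and \<sigma>_id: "\<And>j. j \<le> k \<Longrightarrow> \<sigma> j = j"
    and \<sigma>_end: "\<sigma> (2 * k + 1) = N"
begin

text \<open>Periodic like \<open>star_vertex\<close>, so that the two can agree at every index. At
  \<open>2 * k + 1\<close> it returns to \<open>v 0\<close>, whereas \<open>\<sigma>\<close> has the
  value \<open>N\<close> there.\<close>

definition s :: "nat \<Rightarrow> complex" where
  "s j = v (\<sigma> (j mod (2 * k + 1)))"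

abbreviation V :: "complex set" where
  "V \<equiv> v ` {..<N}"

definition star :: "complex set set" where
  "star = {{s j, s ((j + k) mod (2 * k + 1))} | j. j < 2 * k + 1}"

lemma \<sigma>_N: "j \<le> 2 * k \<Longrightarrow> \<sigma> j < N"
  using \<sigma>_less[of j "2 * k + 1"] \<sigma>_end by simp

lemma \<sigma>_gt: "k < j \<Longrightarrow> j \<le> 2 * k + 1 \<Longrightarrow> k < \<sigma> j"
  using \<sigma>_less[of k j] \<sigma>_id[of k] by simp

lemma \<sigma>_ge: "j \<le> 2 * k + 1 \<Longrightarrow> j \<le> \<sigma> j"
proof (induction j)
  case (Suc j)
  then show ?case using \<sigma>_less[of j "Suc j"] by simp
qed simp

lemma N_ge: "2 * k + 1 \<le> N"
  using \<sigma>_ge[of "2 * k + 1"] \<sigma>_end by simp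

lemma s_\<sigma>: "j \<le> 2 * k \<Longrightarrow> s j = v (\<sigma> j)"
  by (simp add: s_def)

lemma s_v: "j \<le> k \<Longrightarrow> s j = v j"
  by (simp add: s_def \<sigma>_id)

lemma s_end: "s (2 * k + 1) = v 0"
  by (simp add: s_def \<sigma>_id)

lemma v_image: "s ` {0..k} = v ` {0..k}" "s ` {1..k} = v ` {1..k}"
  by (auto simp: s_v)

lemma s_enum: "ccw_enum s (2 * k + 1)"
proof -
  interpret u: ccw_enum "\<lambda>j. v (\<sigma> j)" "2 * k + 1"
    by (rule ccw_enum_sub) (use \<sigma>_less \<sigma>_N in auto)
  show ?thesis
    by unfold_locales (use u.on_circle u.ang_strict in \<open>auto simp: s_\<sigma>\<close>)
qed

text \<open>Apart from \<open>[s\<^sub>0, s\<^sub>k]\<close>, every edge of the star ends at a far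
  vertex \<open>s\<^sub>k\<^sub>+\<^sub>i\<close>, whose two neighbours in the star are
  \<open>s\<^sub>i\<close> and, after wrapping around,
  \<open>s\<^sub>i\<^sub>-\<^sub>1\<close>.\<close>

lemma star_subset:
  assumes "{v 0, v k} \<in> T"
    "\<And>i. 1 \<le> i \<Longrightarrow> i \<le> k \<Longrightarrow> {v i, v (\<sigma> (k + i))} \<in> T"
    "\<And>i. 1 \<le> i \<Longrightarrow> i \<le> k \<Longrightarrow> {v (i - 1), v (\<sigma> (k + i))} \<in> T"
  shows "star \<subseteq> T"
proof
  fix f assume "f \<in> star"
  then obtain j where j: "j < 2 * k + 1" "f = {s j, s ((j + k) mod (2 * k + 1))}"
    by (auto simp: star_def)
  consider "j = 0" | "1 \<le> j" "j \<le> k" | "k < j" by linarith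
  then show "f \<in> T"
  proof cases
    case 1
    then show ?thesis using j assms(1) s_v by simp
  next
    case 2
    then have "f = {v j, v (\<sigma> (k + j))}" using j s_v s_\<sigma>[of "k + j"] by (simp add: add.commute)
    then show ?thesis using assms(2) 2 by simp
  next
    case 3
    define i where "i = j - k"
    have i: "j = k + i" "1 \<le> i" "i \<le> k" using 3 j by (auto simp: i_def)
    have "(j + k) mod (2 * k + 1) = i - 1" using star_mod i by simp
    then have "f = {v (i - 1), v (\<sigma> (k + i))}"
      using j i s_v[of "i - 1"] s_\<sigma>[of j] by (auto simp: insert_commute)
    then show ?thesis using assms(3) i by simp
  qed
qed

lemma shift_V: "shift V (v 0) k = v k"
  using shift_index[of 0 k] N_ge k_pos by simp

text \<open>The other end \<open>v k\<close> does not qualify, since \<open>k\<close> further steps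
  lead to \<open>v (2 * k)\<close>, which differs from \<open>v 0\<close> because
  \<open>2 * k < N\<close>.\<close>

lemma first_vertex_eq: "first_vertex k V {v 0, v k} = v 0"
  unfolding first_vertex_def
proof (rule the_equality)
  show "v 0 \<in> V \<and> {v 0, v k} = {v 0, shift V (v 0) k}"
    using shift_V N_ge by auto
  fix u assume u: "u \<in> V \<and> {v 0, v k} = {u, shift V u k}"
  show "u = v 0"
  proof (rule ccontr)
    assume "u \<noteq> v 0"
    then have "u = v k" "shift V (v k) k = v 0" using u by (auto simp: doubleton_eq_iff)
    moreover have "shift V (v k) k = v (2 * k)"
      using shift_index[of k k] N_ge k_pos by (simp add: mult_2)
    ultimately show False using v_eq_iff[of 0 "2 * k"] N_ge k_pos by simp
  qed
qed

text \<open>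
  A star through \<open>[s\<^sub>0, s\<^sub>k]\<close> contains \<open>s\<^sub>0, \<dots>, s\<^sub>k\<close> as consecutive vertices. As no edge bisects the angle
  of the given star at \<open>s\<^sub>i\<close>, its remaining vertices are pinned from below by increasing induction and
  from above by decreasing induction.
\<close>

lemma star_unique:
  assumes T: "T \<subseteq> edges V"
    and nobis: "\<And>i t. i \<le> k \<Longrightarrow> k < t \<Longrightarrow> t < N \<Longrightarrow> {v i, v t} \<in> T \<Longrightarrow>
      t \<le> \<sigma> (k + i) \<or> \<sigma> (k + i + 1) \<le> t"
    and S: "k_star k S" "S \<subseteq> T" "{v 0, v k} \<in> S"
  shows "S = star"
proof -
  let ?m = "2 * k + 1"
  obtain r where r: "ccw_seq r 0 (2 * k)" "S = {{r j, r ((j + k) mod ?m)} | j. j < ?m}"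
    using S(1) by (auto simp: k_star_def)
  interpret r: ccw_enum r ?m
    by unfold_locales (use r(1) in \<open>auto simp: ccw_seq_def strict_mono_on_def image_subset_iff\<close>)
  define R where "R = r ` {..<?m}"
  \<comment> \<open>This description depends on the vertex set \<open>R\<close> only and allows the
    star to be listed again from \<open>v 0\<close>.\<close>
  have SR: "S = {{x, shift R x k} | x. x \<in> R}"
    unfolding R_def r(2) using k_pos by (intro r.star_as_shift) simp
  have "R \<subseteq> V"
  proof
    fix x assume "x \<in> R"
    then have "{x, shift R x k} \<in> edges V" using SR S(2) T by blast
    then show "x \<in> V" by (auto simp: edges_def doubleton_eq_iff)
  qed
  moreover have "v 0 \<in> R"
  proof -
    obtain j where "j < ?m" "{v 0, v k} = {r j, r ((j + k) mod ?m)}" using S(3) r(2) by auto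
    then show ?thesis
      by (auto simp: R_def doubleton_eq_iff)
  qed
  moreover have "card R = ?m" unfolding R_def using r.inj_v by (simp add: card_image)
  ultimately obtain \<rho> where \<rho>: "\<rho> 0 = 0" "\<And>i j. i < j \<Longrightarrow> j < ?m \<Longrightarrow> \<rho> i < \<rho> j"
    "\<And>j. j < ?m \<Longrightarrow> \<rho> j < N" "R = (\<lambda>j. v (\<rho> j)) ` {..<?m}"
    using subset_enum by blast
  interpret u: ccw_enum "\<lambda>j. v (\<rho> j)" ?m
    by (rule ccw_enum_sub) (use \<rho> in auto)
  have S\<rho>: "S = {{v (\<rho> a), v (\<rho> ((a + k) mod ?m))} | a. a < ?m}"
    unfolding SR \<rho>(4) using k_pos by (intro u.star_as_shift[symmetric]) simp
  have \<rho>_mono: "\<rho> i + (j - i) \<le> \<rho> j" if "i \<le> j" "j < ?m" for i j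
    using strict_gap[of ?m \<rho>] \<rho>(2) that by blast
  have "\<rho> k = k"
  proof -
    obtain a where a: "a < ?m" "{v 0, v k} = {v (\<rho> a), v (\<rho> ((a + k) mod ?m))}"
      using S(3) S\<rho> by auto
    have lt: "\<rho> a < N" "\<rho> ((a + k) mod ?m) < N" "0 < N" "k < N" using \<rho>(3) a N_ge by auto
    from a(2) consider "\<rho> a = 0" "\<rho> ((a + k) mod ?m) = k" | "\<rho> a = k" "\<rho> ((a + k) mod ?m) = 0"
      using lt v_eq_iff by (metis doubleton_eq_iff)
    then show ?thesis
    proof cases
      case 1
      then have "a = 0" using \<rho>_mono[of 0 a] a by auto
      then show ?thesis using 1 by simp
    next
      \<comment> \<open>Traversed in this direction the edge forces \<open>a = k + 1\<close>, whose
        index is at least \<open>k + 1\<close> and cannot be \<open>k\<close>.\<close>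
      case 2
      have "(a + k) mod ?m = 0" using \<rho>_mono[of 0 "(a + k) mod ?m"] 2 by auto
      then have "a + k = ?m"
        using a k_pos by (cases "a + k < ?m") (auto simp: le_mod_geq)
      then show ?thesis using \<rho>_mono[of 0 a] a 2 by auto
    qed
  qed
  then have \<rho>_id: "\<rho> i = i" if "i \<le> k" for i
    using \<rho>_mono[of 0 i] \<rho>_mono[of i k] \<rho>(1) that by auto
  have edge1: "{v i, v (\<rho> (k + i))} \<in> T" if "1 \<le> i" "i \<le> k" for i
  proof -
    have "{v (\<rho> i), v (\<rho> ((i + k) mod ?m))} \<in> S" unfolding S\<rho> using that by force
    then show ?thesis using S(2) \<rho>_id that by (auto simp: add.commute)
  qed
  have edge2: "{v (i - 1), v (\<rho> (k + i))} \<in> T" if "1 \<le> i" "i \<le> k" for i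
  proof -
    have "(k + i + k) mod ?m = i - 1" using star_mod that by simp
    moreover have "{v (\<rho> (k + i)), v (\<rho> ((k + i + k) mod ?m))} \<in> S" unfolding S\<rho> using that by force
    ultimately show ?thesis using S(2) \<rho>_id that by (auto simp: insert_commute)
  qed
  have \<rho>_gt: "k < \<rho> (k + i)" if "1 \<le> i" "i \<le> k" for i
    using \<rho>(2)[of k "k + i"] \<rho>_id[of k] that by simp
  have lower: "\<sigma> (k + i) \<le> \<rho> (k + i)" if "i \<le> k" for i
    using that
  proof (induction i)
    case 0
    then show ?case using \<rho>_id \<sigma>_id by simp
  next
    case (Suc i)
    then have "\<rho> (k + i) < \<rho> (k + Suc i)" using \<rho>(2) by simp
    then show ?case
      using nobis[of i "\<rho> (k + Suc i)"] edge2[of "Suc i"] \<rho>_gt[of "Suc i"] \<rho>(3)[of "k + Suc i"] Suc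
      by auto
  qed
  have upper: "\<rho> (k + i) \<le> \<sigma> (k + i)" if "1 \<le> i" "i \<le> k" for i
    using that(2,1)
  proof (induction i rule: inc_induct)
    \<comment> \<open>In row \<open>k\<close> the second alternative of \<open>nobis\<close> would
      require a column of at least \<open>\<sigma> (2 * k + 1) = N\<close>.\<close>
    case base
    then show ?case
      using nobis[of k "\<rho> (k + k)"] edge1[of k] \<rho>_gt[of k] \<rho>(3)[of "k + k"] \<sigma>_end by (auto simp: mult_2)
  next
    case (step i)
    then have "\<rho> (k + i) < \<rho> (k + Suc i)" using \<rho>(2) by simp
    then show ?case
      using nobis[of i "\<rho> (k + i)"] edge1[of i] \<rho>_gt[of i] \<rho>(3)[of "k + i"] step by auto
  qed
  have eq: "v (\<rho> j) = s j" if "j < ?m" for j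
  proof (cases "j \<le> k")
    case False
    then have "k + (j - k) = j" "1 \<le> j - k" "j - k \<le> k" using that by auto
    then have "\<rho> j = \<sigma> j"
      using lower[of "j - k"] upper[of "j - k"] by simp
    then show ?thesis using s_\<sigma> that by simp
  qed (simp add: \<rho>_id s_v)
  have "{v (\<rho> a), v (\<rho> ((a + k) mod ?m))} = {s a, s ((a + k) mod ?m)}" if "a < ?m" for a
    using eq that by simp
  then show ?thesis unfolding S\<rho> star_def by (intro Collect_cong) auto
qed

text \<open>Evaluates the definite description in \<open>star_of\<close> for both directions:
  existence is \<open>star \<subseteq> T\<close>, uniqueness is \<open>star_unique\<close>.\<close>

lemma star_vertex_eq:
  assumes T: "T \<subseteq> edges V"
    and nobis: "\<And>i t. i \<le> k \<Longrightarrow> k < t \<Longrightarrow> t < N \<Longrightarrow> {v i, v t} \<in> T \<Longrightarrow>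
      t \<le> \<sigma> (k + i) \<or> \<sigma> (k + i + 1) \<le> t"
    and "star \<subseteq> T"
  shows "star_vertex k V T {v 0, v k} = s"
proof
  fix j
  interpret s: ccw_enum s "2 * k + 1" by (rule s_enum)
  have mem: "{v 0, v k} \<in> star"
    unfolding star_def using s_v[of 0] s_v[of k] by force
  have "k_star k star"
    unfolding k_star_def star_def using s.on_circle s.ang_strict
    by (intro exI[of _ s]) (auto simp: ccw_seq_def strict_mono_on_def)
  then have "star_of k T {v 0, v k} = star"
    unfolding star_of_def using assms star_unique mem by (intro the_equality) blast+
  moreover have "\<Union>star = s ` {..<2 * k + 1}"
  proof
    show "\<Union>star \<subseteq> s ` {..<2 * k + 1}" by (auto simp: star_def)
    show "s ` {..<2 * k + 1} \<subseteq> \<Union>star" unfolding star_def by blast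
  qed
  moreover have "shift (s ` {..<2 * k + 1}) (s 0) j = s (j mod (2 * k + 1))"
    using s.shift_index[of 0 j] k_pos by simp
  ultimately show "star_vertex k V T {v 0, v k} j = s j"
    unfolding star_vertex_def first_vertex_eq using s_v[of 0] by (simp add: s_def)
qed

end

section \<open>Flattening and inflating in terms of indices\<close>

context star_frame
begin

lemma flatten_step_index:
  assumes ab: "a < b" "b < N"
  shows "flatten_step k s {v a, v b} g \<longleftrightarrow>
    (k < a \<or> 1 \<le> a \<and> b \<le> k) \<and> g = {v a, v b} \<or>
    a \<le> k \<and> k < b \<and> (b \<le> \<sigma> (k + a) \<and> g = {v a, v b} \<or> \<sigma> (k + a + 1) \<le> b \<and> g = {v (a + 1), v b})"
proof -
  have far: "{v a, v b} \<inter> s ` {0..k} = {} \<longleftrightarrow> k < a"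
    unfolding v_image using ab N_ge v_eq_iff by (auto simp: image_iff)
  have near: "{v a, v b} \<subseteq> s ` {1..k} \<longleftrightarrow> 1 \<le> a \<and> b \<le> k"
    unfolding v_image using ab N_ge v_eq_iff by (auto simp: image_iff)
  have oc: "v c \<in> arc_oc (s k) (s (k + i)) \<longleftrightarrow> k < c \<and> c \<le> \<sigma> (k + i)" if "i \<le> k" "c < N" for i c
    using arc_oc_iff[of k "\<sigma> (k + i)" c] s_v[of k] s_\<sigma>[of "k + i"] \<sigma>_N[of "k + i"] \<sigma>_ge[of "k + i"] that
    by simp
  have co: "v c \<in> arc_co (s (k + i + 1)) (s 0) \<longleftrightarrow> \<sigma> (k + i + 1) \<le> c" if "i \<le> k" "c < N" for i c
  proof (cases "i = k")
    \<comment> \<open>The arc from \<open>s\<^sub>0\<close> to \<open>s\<^sub>0\<close> is empty,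
      which agrees with the threshold \<open>N\<close> being past every column.\<close>
    case True
    then have "s (k + i + 1) = v 0" using s_end by (simp add: mult_2)
    then show ?thesis
      using True that \<sigma>_end ang_nonneg[of "v 0" "v c"] ang_self[of "v 0"] on_circle[of 0] s_v[of 0]
      by (auto simp: arc_co_def mult_2)
  next
    case False
    then show ?thesis
      using arc_co_iff[of 0 "\<sigma> (k + i + 1)" c] \<sigma>_gt[of "k + i + 1"] \<sigma>_N[of "k + i + 1"]
        s_v[of 0] s_\<sigma>[of "k + i + 1"] that by simp
  qed
  have step: "(\<exists>i t. i \<le> k \<and> {v a, v b} = {s i, t} \<and>
        (t \<in> arc_oc (s k) (s (k + i)) \<and> g = {s i, t} \<or>
         t \<in> arc_co (s (k + i + 1)) (s 0) \<and> g = {s (i + 1), t})) \<longleftrightarrow>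
      a \<le> k \<and> k < b \<and> (b \<le> \<sigma> (k + a) \<and> g = {v a, v b} \<or> \<sigma> (k + a + 1) \<le> b \<and> g = {v (a + 1), v b})"
    (is "?L \<longleftrightarrow> ?R")
  proof
    assume ?L
    then obtain i t where i: "i \<le> k" "{v a, v b} = {v i, t}" and
      t: "t \<in> arc_oc (s k) (s (k + i)) \<and> g = {v i, t} \<or>
         t \<in> arc_co (s (k + i + 1)) (s 0) \<and> g = {s (i + 1), t}"
      using s_v by auto
    have iN: "i < N" using i N_ge by simp
    from i(2) consider "i = a" "t = v b" | "i = b" "t = v a"
      using v_eq_iff[of i a] v_eq_iff[of i b] iN ab by (auto simp: doubleton_eq_iff)
    then show ?R
    proof cases
      case 1
      have ak: "a \<le> k" using i(1) 1 by simp
      have "k < b \<and> b \<le> \<sigma> (k + a) \<and> g = {v a, v b} \<or> \<sigma> (k + a + 1) \<le> b \<and> g = {s (a + 1), v b}"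
        using t oc[OF ak ab(2)] co[OF ak ab(2)] unfolding 1 by simp
      then show ?thesis
      proof
        assume b: "\<sigma> (k + a + 1) \<le> b \<and> g = {s (a + 1), v b}"
        then have "a < k" using ak \<sigma>_end ab(2) by (cases "a = k") (auto simp: mult_2)
        then show ?thesis using b \<sigma>_gt[of "k + a + 1"] s_v[of "a + 1"] by simp
      qed (use ak in simp)
    next
      \<comment> \<open>If \<open>i\<close> is the larger index, the other end lies below
        \<open>k\<close> and therefore in neither arc.\<close>
      case 2
      then show ?thesis
        using t oc[OF i(1), of a] co[OF i(1), of a] \<sigma>_gt[of "k + i + 1"] ab i(1) by simp
    qed
  next
    assume R: ?R
    have "s (a + 1) = v (a + 1)" if "\<sigma> (k + a + 1) \<le> b"
      using that R \<sigma>_end ab s_v[of "a + 1"] by (cases "a = k") (auto simp: mult_2)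
    then have "b \<le> \<sigma> (k + a) \<and> g = {s a, v b} \<or> \<sigma> (k + a + 1) \<le> b \<and> g = {s (a + 1), v b}"
      using R s_v[of a] by auto
    then show ?L
      using oc[of a b] co[of a b] R ab s_v[of a] by (intro exI[of _ a] exI[of _ "v b"]) auto
  qed
  show ?thesis unfolding flatten_step_def far near step by blast
qed

text \<open>Flattening along the fixed vertices \<open>s\<close>, which can be studied before
  \<open>star_vertex\<close> is known to return them.\<close>

definition flat :: "complex set set \<Rightarrow> complex set set" where
  "flat T = {g. \<exists>f\<in>T. flatten_step k s f g}"

lemma flat_mem:
  assumes T: "T \<subseteq> edges V"
  shows "g \<in> flat T \<longleftrightarrow> (\<exists>a b. a < b \<and> b < N \<and> {v a, v b} \<in> T \<and>
    ((k < a \<or> 1 \<le> a \<and> b \<le> k) \<and> g = {v a, v b} \<or>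
    a \<le> k \<and> k < b \<and> (b \<le> \<sigma> (k + a) \<and> g = {v a, v b} \<or> \<sigma> (k + a + 1) \<le> b \<and> g = {v (a + 1), v b})))"
  (is "?L \<longleftrightarrow> ?R")
proof
  assume ?L
  then obtain f where f: "f \<in> T" "flatten_step k s f g" by (auto simp: flat_def)
  then obtain a b where ab: "a < b" "b < N" "f = {v a, v b}"
    using T edges_index[of "{..<N}" f] by auto
  then show ?R
    using f flatten_step_index[OF ab(1,2)] by blast
next
  assume ?R
  then obtain a b where "a < b" "b < N" "{v a, v b} \<in> T" "flatten_step k s {v a, v b} g"
    using flatten_step_index by metis
  then show ?L unfolding flat_def by blast
qed

lemma moved_less_k: "a \<le> k \<Longrightarrow> b < N \<Longrightarrow> \<sigma> (k + a + 1) \<le> b \<Longrightarrow> a < k"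
  using \<sigma>_end by (cases "a = k") (auto simp: mult_2)

lemma flat_edges:
  assumes T: "T \<subseteq> edges V"
  shows "flat T \<subseteq> edges (v ` {1..<N})"
proof
  fix g assume "g \<in> flat T"
  then obtain a b where ab: "a < b" "b < N" and
    g: "(k < a \<or> 1 \<le> a \<and> b \<le> k) \<and> g = {v a, v b} \<or>
    a \<le> k \<and> k < b \<and> (b \<le> \<sigma> (k + a) \<and> g = {v a, v b} \<or> \<sigma> (k + a + 1) \<le> b \<and> g = {v (a + 1), v b})"
    unfolding flat_mem[OF T] by blast
  \<comment> \<open>In row \<open>0\<close> the kept range \<open>k < b \<le> \<sigma> k = k\<close>
    is empty, so no edge at \<open>v 0\<close> survives.\<close>
  have "1 \<le> a" if "k < b" "b \<le> \<sigma> (k + a)"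
    using that \<sigma>_id[of k] by (cases "a = 0") auto
  moreover have "a + 1 < b" if "a \<le> k" "k < b" "\<sigma> (k + a + 1) \<le> b"
    using moved_less_k[of a b] that ab by auto
  ultimately have "1 \<le> a \<and> g = {v a, v b} \<or> a + 1 < b \<and> g = {v (a + 1), v b}"
    using g by auto
  then have "\<exists>c d. c \<in> {1..<N} \<and> d \<in> {1..<N} \<and> c < d \<and> g = {v c, v d}"
  proof
    assume "1 \<le> a \<and> g = {v a, v b}"
    then show ?thesis using ab by (intro exI[of _ a] exI[of _ b]) auto
  next
    assume "a + 1 < b \<and> g = {v (a + 1), v b}"
    then show ?thesis using ab by (intro exI[of _ "a + 1"] exI[of _ b]) auto
  qed
  moreover have "{1..<N} \<subseteq> {..<N}" by auto
  ultimately show "g \<in> edges (v ` {1..<N})"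
    by (simp only: edges_index)
qed

text \<open>For a column beyond \<open>k\<close>, an edge of row \<open>c \<le> k\<close> is either
  kept from row \<open>c\<close> or moved from row \<open>c - 1\<close>. Both have the threshold
  \<open>\<sigma> (k + c)\<close>, and only at that column can it arise in both ways.\<close>

lemma flat_index:
  assumes T: "T \<subseteq> edges V" and cd: "1 \<le> c" "c < d" "d < N"
  shows "{v c, v d} \<in> flat T \<longleftrightarrow>
    (if k < c \<or> d \<le> k then {v c, v d} \<in> T
     else d \<le> \<sigma> (k + c) \<and> {v c, v d} \<in> T \<or> \<sigma> (k + c) \<le> d \<and> {v (c - 1), v d} \<in> T)"
  (is "?L \<longleftrightarrow> ?R")
proof
  assume ?L
  then obtain a b where ab: "a < b" "b < N" "{v a, v b} \<in> T" and
    g: "(k < a \<or> 1 \<le> a \<and> b \<le> k) \<and> {v c, v d} = {v a, v b} \<or>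
    a \<le> k \<and> k < b \<and> (b \<le> \<sigma> (k + a) \<and> {v c, v d} = {v a, v b} \<or>
      \<sigma> (k + a + 1) \<le> b \<and> {v c, v d} = {v (a + 1), v b})"
    unfolding flat_mem[OF T] by blast
  have same: "c = a \<and> d = b" if "{v c, v d} = {v a, v b}"
    using that chord_eq_iff cd ab by simp
  have moved: "c = a + 1 \<and> d = b \<and> a < k"
    if "{v c, v d} = {v (a + 1), v b}" "a \<le> k" "k < b" "\<sigma> (k + a + 1) \<le> b"
    using that moved_less_k[of a b] chord_eq_iff[of c d "a + 1" b] cd ab by simp
  from g show ?R
  proof (elim disjE conjE)
    assume eq: "{v c, v d} = {v (a + 1), v b}" and a: "a \<le> k" "k < b" "\<sigma> (k + a + 1) \<le> b"
    then show ?thesis using moved[OF eq a] ab by simp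
  qed (use same ab in simp_all)
next
  assume R: ?R
  have mem: "{v c, v d} \<in> flat T"
    if "a < b" "b < N" "{v a, v b} \<in> T" "flatten_step k s {v a, v b} {v c, v d}" for a b
    unfolding flat_def using that by blast
  show ?L
  proof (cases "k < c \<or> d \<le> k")
    case True
    then show ?thesis
      using R cd by (intro mem[of c d]) (simp_all add: flatten_step_index)
  next
    case False
    then have "d \<le> \<sigma> (k + c) \<and> {v c, v d} \<in> T \<or> \<sigma> (k + c) \<le> d \<and> {v (c - 1), v d} \<in> T"
      using R by simp
    then show ?thesis
    proof
      assume "d \<le> \<sigma> (k + c) \<and> {v c, v d} \<in> T"
      then show ?thesis
        using False cd by (intro mem[of c d]) (simp_all add: flatten_step_index)
    next
      assume "\<sigma> (k + c) \<le> d \<and> {v (c - 1), v d} \<in> T"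
      moreover obtain a where "c = Suc a" using cd(1) by (cases c) auto
      ultimately show ?thesis
        using False cd by (intro mem[of a d]) (simp_all add: flatten_step_index)
    qed
  qed
qed

section \<open>Inflating along the glued edges\<close>

definition glue :: "complex set set" where
  "glue = {{s i, s (k + i)} | i. i \<in> {1..k}}"

lemma Union_glue: "\<Union>glue = (\<lambda>j. s (j + 1)) ` {..<2 * k}"
proof -
  have "\<Union>glue = s ` {1..k} \<union> (\<lambda>i. s (k + i)) ` {1..k}"
    unfolding glue_def by blast
  also have "\<dots> = s ` ({1..k} \<union> (+) k ` {1..k})"
    by (simp only: image_Un image_image)
  also have "(+) k ` {1..k} = {k + 1..k + k}"
    by simp
  also have "{1..k} \<union> {k + 1..k + k} = Suc ` {..<2 * k}"
    unfolding image_Suc_lessThan by auto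
  finally show ?thesis by (simp add: image_image)
qed

lemma tail_enum: "ccw_enum (\<lambda>j. s (j + 1)) (2 * k)"
  using ccw_enum.ccw_enum_sub[OF s_enum, of "2 * k" "\<lambda>j. j + 1"] by simp

lemma shift_glue: "j < 2 * k \<Longrightarrow> shift (\<Union>glue) (s 1) j = s (j + 1)"
  using ccw_enum.shift_index[OF tail_enum, of 0 j] k_pos by (simp add: Union_glue)

text \<open>Restricted to \<open>j \<le> 2 * k\<close>, since beyond that
  \<open>crossing_vertex\<close> returns to \<open>s 1\<close> while \<open>s\<close> returns to
  \<open>s 0\<close>.\<close>

lemma crossing_vertex_glue: "j \<le> 2 * k \<Longrightarrow> crossing_vertex glue (s 1) (s 0) j = s j"
  using shift_glue[of "j - 1"] by (cases j) (auto simp: crossing_vertex_def)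

definition infl :: "complex set set \<Rightarrow> complex set set" where
  "infl T = inflating k T glue (s 1) (s 0)"

lemma v_mem_iff: "j < N \<Longrightarrow> v j \<in> v ` {1..k} \<longleftrightarrow> j \<in> {1..k}"
  by (rule inj_on_image_mem_iff[OF inj_v]) (use N_ge in auto)

lemma tail_chord:
  assumes "T \<subseteq> edges (v ` {1..<N})" "g \<in> T"
  obtains a b where "1 \<le> a" "a < b" "b < N" "g = {v a, v b}"
proof -
  have "g \<in> edges (v ` {1..<N})" using assms by blast
  moreover have "{1..<N} \<subseteq> {..<N}" by auto
  ultimately obtain a b where "a \<in> {1..<N}" "b \<in> {1..<N}" "a < b" "g = {v a, v b}"
    using edges_index by metis
  then show ?thesis using that by simp
qed

lemma infl_far:
  assumes T: "T \<subseteq> edges (v ` {1..<N})"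
  shows "g \<in> T \<and> g \<inter> v ` {1..k} = {} \<longleftrightarrow> (\<exists>a b. a < b \<and> b < N \<and> g = {v a, v b} \<and> k < a \<and> g \<in> T)"
proof
  assume g: "g \<in> T \<and> g \<inter> v ` {1..k} = {}"
  then have "g \<in> T" ..
  then obtain a b where ab: "1 \<le> a" "a < b" "b < N" "g = {v a, v b}"
    by (rule tail_chord[OF T])
  then have "k < a" using g v_mem_iff[of a] by simp
  then show "\<exists>a b. a < b \<and> b < N \<and> g = {v a, v b} \<and> k < a \<and> g \<in> T"
    using g ab by (intro exI[of _ a] exI[of _ b]) simp
next
  assume "\<exists>a b. a < b \<and> b < N \<and> g = {v a, v b} \<and> k < a \<and> g \<in> T"
  then obtain a b where ab: "a < b" "b < N" "g = {v a, v b}" "k < a" "g \<in> T"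
    by (elim exE conjE)
  have "v a \<notin> v ` {1..k}" "v b \<notin> v ` {1..k}" using ab v_mem_iff[of a] v_mem_iff[of b] by auto
  then show "g \<in> T \<and> g \<inter> v ` {1..k} = {}"
    using ab(3,5) by simp
qed

lemma infl_near:
  assumes T: "T \<subseteq> edges (v ` {1..<N})"
  shows "g \<in> T \<and> g \<subseteq> v ` {1..k} \<longleftrightarrow>
      (\<exists>a b. a < b \<and> b < N \<and> g = {v a, v b} \<and> 1 \<le> a \<and> b \<le> k \<and> g \<in> T)"
proof
  assume g: "g \<in> T \<and> g \<subseteq> v ` {1..k}"
  then have "g \<in> T" ..
  then obtain a b where ab: "1 \<le> a" "a < b" "b < N" "g = {v a, v b}"
    by (rule tail_chord[OF T])
  then have "b \<le> k" using g v_mem_iff[of b] by simp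
  then show "\<exists>a b. a < b \<and> b < N \<and> g = {v a, v b} \<and> 1 \<le> a \<and> b \<le> k \<and> g \<in> T"
    using g ab by (intro exI[of _ a] exI[of _ b]) simp
next
  assume "\<exists>a b. a < b \<and> b < N \<and> g = {v a, v b} \<and> 1 \<le> a \<and> b \<le> k \<and> g \<in> T"
  then obtain a b where ab: "a < b" "b < N" "g = {v a, v b}" "1 \<le> a" "b \<le> k" "g \<in> T"
    by (elim exE conjE)
  then show "g \<in> T \<and> g \<subseteq> v ` {1..k}" by auto
qed

lemma infl_new:
  "(\<exists>i. g = {s 0, s i} \<and> i \<in> {1..k}) \<longleftrightarrow> (\<exists>a b. a < b \<and> b < N \<and> g = {v a, v b} \<and> a = 0 \<and> b \<le> k)"
proof
  assume "\<exists>i. g = {s 0, s i} \<and> i \<in> {1..k}"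
  then obtain i where "g = {s 0, s i}" "1 \<le> i" "i \<le> k" by auto
  then show "\<exists>a b. a < b \<and> b < N \<and> g = {v a, v b} \<and> a = 0 \<and> b \<le> k"
    using N_ge s_v[of 0] s_v[of i] by (intro exI[of _ 0] exI[of _ i]) simp
next
  assume "\<exists>a b. a < b \<and> b < N \<and> g = {v a, v b} \<and> a = 0 \<and> b \<le> k"
  then obtain b where b: "0 < b" "b \<le> k" "g = {v 0, v b}"
    by (elim exE conjE) simp
  then show "\<exists>i. g = {s 0, s i} \<and> i \<in> {1..k}"
    using s_v[of 0] s_v[of b] by (intro exI[of _ b]) simp
qed

lemma tail_neighbour:
  assumes "T \<subseteq> edges (v ` {1..<N})" "{v i, t} \<in> T"
  obtains b where "1 \<le> b" "b < N" "t = v b"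
proof -
  obtain a b where "1 \<le> a" "a < b" "b < N" "{v i, t} = {v a, v b}"
    using assms by (rule tail_chord)
  then show ?thesis
    using that[of a] that[of b] by (auto simp: doubleton_eq_iff)
qed

lemma infl_keep:
  assumes T: "T \<subseteq> edges (v ` {1..<N})"
  shows "(\<exists>i t. g = {s i, t} \<and> i \<in> {1..k} \<and> {s i, t} \<in> T \<and> t \<in> arc_oc (s k) (s (k + i))) \<longleftrightarrow>
      (\<exists>a b. a < b \<and> b < N \<and> g = {v a, v b} \<and> a \<le> k \<and> k < b \<and> b \<le> \<sigma> (k + a) \<and> {v a, v b} \<in> T)"
    (is "?L \<longleftrightarrow> ?R")
proof
  assume ?L
  then obtain i t where i: "g = {s i, t}" "i \<in> {1..k}" "{s i, t} \<in> T" "t \<in> arc_oc (s k) (s (k + i))"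
    by (elim exE conjE)
  then have i': "g = {v i, t}" "{v i, t} \<in> T" "t \<in> arc_oc (v k) (v (\<sigma> (k + i)))"
    using s_v[of i] s_v[of k] s_\<sigma>[of "k + i"] by simp_all
  obtain b where b: "1 \<le> b" "b < N" "t = v b" using T i'(2) by (rule tail_neighbour)
  then have "k < b" "b \<le> \<sigma> (k + i)"
    using i i' arc_oc_iff[of k "\<sigma> (k + i)" b] \<sigma>_N[of "k + i"] \<sigma>_ge[of "k + i"] by auto
  then show ?R using i(2) i' b by (intro exI[of _ i] exI[of _ b]) simp
next
  assume ?R
  then obtain a b where ab: "a < b" "b < N" "g = {v a, v b}" "a \<le> k" "k < b" "b \<le> \<sigma> (k + a)" "{v a, v b} \<in> T"
    by (elim exE conjE)
  \<comment> \<open>Row \<open>0\<close> has an empty kept range because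
    \<open>\<sigma> k = k\<close>.\<close>
  have "a \<noteq> 0" using ab \<sigma>_id[of k] by (cases "a = 0") auto
  moreover have "v b \<in> arc_oc (s k) (s (k + a))"
    using ab s_v[of k] s_\<sigma>[of "k + a"] arc_oc_iff[of k "\<sigma> (k + a)" b] \<sigma>_N[of "k + a"] \<sigma>_ge[of "k + a"]
    by simp
  ultimately show ?L
    using ab s_v[of a] by (intro exI[of _ a] exI[of _ "v b"]) simp
qed

lemma infl_move:
  assumes T: "T \<subseteq> edges (v ` {1..<N})"
  shows "(\<exists>i t. g = {s (i - 1), t} \<and> i \<in> {1..k} \<and> {s i, t} \<in> T \<and> t \<in> arc_co (s (k + i)) (s 1)) \<longleftrightarrow>
      (\<exists>a b. a < b \<and> b < N \<and> g = {v a, v b} \<and> a < k \<and> \<sigma> (k + a + 1) \<le> b \<and> {v (a + 1), v b} \<in> T)"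
    (is "?L \<longleftrightarrow> ?R")
proof
  assume ?L
  then obtain i t where i: "g = {s (i - 1), t}" "i \<in> {1..k}" "{s i, t} \<in> T" "t \<in> arc_co (s (k + i)) (s 1)"
    by (elim exE conjE)
  then have i': "g = {v (i - 1), t}" "{v i, t} \<in> T" "t \<in> arc_co (v (\<sigma> (k + i))) (v 1)"
    using s_v[of i] s_v[OF le_trans[OF diff_le_self, of i k 1]] s_v[of 1] s_\<sigma>[of "k + i"] k_pos by simp_all
  obtain b where b: "1 \<le> b" "b < N" "t = v b" using T i'(2) by (rule tail_neighbour)
  have "k < \<sigma> (k + i)" "\<sigma> (k + i) < N" using i \<sigma>_N[of "k + i"] \<sigma>_gt[of "k + i"] by auto
  moreover have "\<sigma> (k + i) \<le> b"
    using calculation i'(3) b arc_co_iff[of 1 "\<sigma> (k + i)" b] k_pos by simp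
  moreover have "k + (i - 1) + 1 = k + i" "i - 1 + 1 = i" using i by auto
  moreover have "i - 1 < b" "i - 1 < k" using calculation i(2) by auto
  ultimately show ?R using i' b by (intro exI[of _ "i - 1"] exI[of _ b]) simp
next
  assume ?R
  then obtain a b where ab: "a < b" "b < N" "g = {v a, v b}" "a < k" "\<sigma> (k + a + 1) \<le> b" "{v (a + 1), v b} \<in> T"
    by (elim exE conjE)
  then have "v b \<in> arc_co (s (k + (a + 1))) (s 1)"
    using arc_co_iff[of 1 "\<sigma> (k + (a + 1))" b] \<sigma>_N[of "k + (a + 1)"] \<sigma>_gt[of "k + (a + 1)"] k_pos
      s_v[of 1] s_\<sigma>[of "k + (a + 1)"] by simp
  then show ?L
    using ab s_v[of a] s_v[of "a + 1"] by (intro exI[of _ "a + 1"] exI[of _ "v b"]) simp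
qed

lemma infl_mem:
  assumes T: "T \<subseteq> edges (v ` {1..<N})"
  shows "g \<in> infl T \<longleftrightarrow> (\<exists>a b. a < b \<and> b < N \<and> g = {v a, v b} \<and>
    ((k < a \<or> 1 \<le> a \<and> b \<le> k) \<and> g \<in> T \<or> a = 0 \<and> b \<le> k \<or>
     a \<le> k \<and> k < b \<and> b \<le> \<sigma> (k + a) \<and> {v a, v b} \<in> T \<or>
     a < k \<and> \<sigma> (k + a + 1) \<le> b \<and> {v (a + 1), v b} \<in> T))"
  (is "_ \<longleftrightarrow> (\<exists>a b. ?P a b)")
proof -
  let ?c = "crossing_vertex glue (s 1) (s 0)"
  have c: "?c j = s j" if "j \<le> 2 * k" for j using crossing_vertex_glue that .
  have c0: "?c ` {1..k} = v ` {1..k}" using c s_v by (intro image_cong) auto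
  have c1: "?c i = s i \<and> ?c (i - 1) = s (i - 1) \<and> ?c (k + i) = s (k + i)" if "i \<in> {1..k}" for i
    using that c[of i] c[of "i - 1"] c[of "k + i"] by force
  have c2: "?c 0 = s 0" "?c k = s k" "?c 1 = s 1" using c k_pos by simp_all
  have "g \<in> infl T \<longleftrightarrow> (g \<in> T \<and> g \<inter> ?c ` {1..k} = {}) \<or> (g \<in> T \<and> g \<subseteq> ?c ` {1..k}) \<or>
    (\<exists>i. g = {?c 0, ?c i} \<and> i \<in> {1..k}) \<or>
    (\<exists>i t. g = {?c i, t} \<and> i \<in> {1..k} \<and> {?c i, t} \<in> T \<and> t \<in> arc_oc (?c k) (?c (k + i))) \<or>
    (\<exists>i t. g = {?c (i - 1), t} \<and> i \<in> {1..k} \<and> {?c i, t} \<in> T \<and> t \<in> arc_co (?c (k + i)) (?c 1))"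
    unfolding infl_def inflating_def Let_def Un_iff mem_Collect_eq by (simp only: disj_assoc)
  also have "\<dots> \<longleftrightarrow> (g \<in> T \<and> g \<inter> v ` {1..k} = {}) \<or> (g \<in> T \<and> g \<subseteq> v ` {1..k}) \<or>
    (\<exists>i. g = {s 0, s i} \<and> i \<in> {1..k}) \<or>
    (\<exists>i t. g = {s i, t} \<and> i \<in> {1..k} \<and> {s i, t} \<in> T \<and> t \<in> arc_oc (s k) (s (k + i))) \<or>
    (\<exists>i t. g = {s (i - 1), t} \<and> i \<in> {1..k} \<and> {s i, t} \<in> T \<and> t \<in> arc_co (s (k + i)) (s 1))"
    unfolding c0 c2
    by (intro arg_cong2[where f = "(\<or>)"] refl iff_exI) (use c1 in metis)+
  also have "\<dots> \<longleftrightarrow> (\<exists>a b. ?P a b)"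
    unfolding infl_far[OF T] infl_near[OF T] infl_new infl_keep[OF T] infl_move[OF T]
      ex_disj_distrib[symmetric]
    by (intro iff_exI) (simp only: conj_disj_distribL conj_disj_distribR conj_assoc disj_assoc)
  finally show ?thesis .
qed

lemma infl_edges:
  assumes T: "T \<subseteq> edges (v ` {1..<N})"
  shows "infl T \<subseteq> edges V"
proof
  fix g assume "g \<in> infl T"
  then obtain a b where "a < b" "b < N" "g = {v a, v b}"
    unfolding infl_mem[OF T] by (elim exE conjE)
  then show "g \<in> edges V"
    unfolding edges_index[OF order_refl] by (intro exI[of _ a] exI[of _ b]) simp
qed

lemma infl_index:
  assumes T: "T \<subseteq> edges (v ` {1..<N})" and ab: "a < b" "b < N"
  shows "{v a, v b} \<in> infl T \<longleftrightarrow>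
     (k < a \<or> 1 \<le> a \<and> b \<le> k) \<and> {v a, v b} \<in> T \<or> a = 0 \<and> b \<le> k \<or>
     a \<le> k \<and> k < b \<and> b \<le> \<sigma> (k + a) \<and> {v a, v b} \<in> T \<or>
     a < k \<and> \<sigma> (k + a + 1) \<le> b \<and> {v (a + 1), v b} \<in> T"
proof -
  have eq: "a' = a \<and> b' = b" if "a' < b'" "b' < N" "{v a, v b} = {v a', v b'}" for a' b'
    using chord_eq_iff[of a b a' b'] ab that by simp
  show ?thesis unfolding infl_mem[OF T]
  proof (rule iffI, goal_cases)
    case 1
    then obtain a' b' where *: "a' < b'" "b' < N" "{v a, v b} = {v a', v b'}" and
      "(k < a' \<or> 1 \<le> a' \<and> b' \<le> k) \<and> {v a, v b} \<in> T \<or> a' = 0 \<and> b' \<le> k \<or>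
       a' \<le> k \<and> k < b' \<and> b' \<le> \<sigma> (k + a') \<and> {v a', v b'} \<in> T \<or>
       a' < k \<and> \<sigma> (k + a' + 1) \<le> b' \<and> {v (a' + 1), v b'} \<in> T"
      by (elim exE conjE)
    then show ?case using eq[OF *] by simp
  next
    case 2
    then show ?case using ab by (intro exI[of _ a] exI[of _ b]) simp
  qed
qed

end

section \<open>Flattening after inflating\<close>

lemma edges_mono: "A \<subseteq> B \<Longrightarrow> edges A \<subseteq> edges B"
  unfolding edges_def by blast

context ccw_enum
begin

lemma tail_ccw_enum: "ccw_enum (\<lambda>j. v (j + 1)) (N - 1)"
  by (rule ccw_enum_sub) auto

lemma tail_image: "(\<lambda>j. v (j + 1)) ` {..<N - 1} = v ` {1..<N}"
proof -
  have "Suc ` {..<N - 1} = {1..<N}"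
    unfolding image_Suc_lessThan by auto
  then show ?thesis by (simp add: image_image[of v Suc, symmetric])
qed

lemma shift_tail: "3 \<le> N \<Longrightarrow> j < N - 1 \<Longrightarrow> shift (v ` {1..<N}) (v 1) j = v (j + 1)"
  using ccw_enum.shift_index[OF tail_ccw_enum, of 0 j, unfolded tail_image] by simp

lemma succ_tail:
  assumes "3 \<le> N" "1 \<le> c" "c < N"
  shows "ccw_succ (v ` {1..<N}) (v c) = (if c + 1 < N then v (c + 1) else v 1)"
proof -
  have "ccw_succ (v ` {1..<N}) (v (c - 1 + 1)) = v ((c - 1 + 1) mod (N - 1) + 1)"
    using ccw_enum.succ_index[OF tail_ccw_enum, of "c - 1"] assms by (simp only: tail_image)
  moreover have "c mod (N - 1) = (if c + 1 < N then c else 0)"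
  proof (cases "c + 1 < N")
    case False
    then have "c = N - 1" using assms by simp
    then show ?thesis using False by simp
  qed simp
  ultimately show ?thesis using assms by simp
qed

lemma zero_in_arc:
  assumes "3 \<le> N" "1 \<le> c" "c < N" "1 \<le> d" "d < N"
  shows "v 0 \<in> arc_oo (v c) (v d) \<longleftrightarrow> d \<le> c \<and> d \<noteq> c"
proof -
  have "\<theta> 0 = 0" using ang_self on_circle assms by simp
  then show ?thesis
    using ang_index[of c 0] ang_index[of c d] \<theta>_less_iff[of 0 d] on_circle[of 0] assms
      ang_less[of "v 0" "v d"] ang_less[of "v 0" "v c"] by (auto simp: arc_oo_def)
qed

lemma new_vertex_tail:
  assumes "3 \<le> N"
  shows "new_vertex (v ` {1..<N}) (v 1) (v 0)"
proof -
  have "ccw_succ (v ` {1..<N}) (v (N - 1)) = v 1"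
    using succ_tail[of "N - 1"] assms by simp
  moreover have "v 0 \<in> arc_oo (v (N - 1)) (v 1)"
    using zero_in_arc[of "N - 1" 1] assms by simp
  moreover have "v (N - 1) \<in> v ` {1..<N}" using assms by simp
  ultimately show ?thesis unfolding new_vertex_def by blast
qed

text \<open>Among the arcs from a vertex to its successor, only the one closing the cycle from
  \<open>v (N - 1)\<close> to \<open>v 1\<close> passes over \<open>v 0\<close>.\<close>

lemma new_vertex_first:
  assumes "3 \<le> N" "new_vertex (v ` {1..<N}) x (v 0)"
  shows "x = v 1"
proof -
  obtain p where p: "p \<in> v ` {1..<N}" "ccw_succ (v ` {1..<N}) p = x" "v 0 \<in> arc_oo p x"
    using assms(2) unfolding new_vertex_def by blast
  then obtain c where c: "1 \<le> c" "c < N" "p = v c" by auto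
  have x: "x = (if c + 1 < N then v (c + 1) else v 1)"
    using succ_tail[OF assms(1) c(1,2)] p(2) c(3) by simp
  show ?thesis
  proof (cases "c + 1 < N")
    case True
    then have "v 0 \<in> arc_oo (v c) (v (c + 1))" using p(3) c(3) x by simp
    then show ?thesis using zero_in_arc[of c "c + 1"] assms(1) c True by simp
  qed (use x in simp)
qed

text \<open>Interleaving edges share no endpoint. For the inflated crossing this yields its
  \<open>2 * k\<close> vertices and hence a polygon large enough for a star.\<close>

lemma card_Union_crossing:
  assumes "E \<subseteq> edges (v ` {..<N})" "crossing l E"
  shows "card (\<Union>E) = 2 * l"
proof -
  have ind: "\<exists>a b. a < b \<and> b < N \<and> f = {v a, v b}" if "f \<in> E" for f
    using subsetD[OF assms(1) that] unfolding edges_index[OF order_refl] by auto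
  have two: "finite f \<and> card f = 2" if f: "f \<in> E" for f
  proof -
    obtain a b where "a < b" "b < N" "f = {v a, v b}" using ind[OF f] by (elim exE conjE)
    then show ?thesis using v_eq_iff[of a b] by simp
  qed
  have "pairwise disjnt E"
  proof (rule pairwiseI)
    fix f g assume fg: "f \<in> E" "g \<in> E" "f \<noteq> g"
    obtain a b where ab: "a < b" "b < N" "f = {v a, v b}" using ind[OF fg(1)] by (elim exE conjE)
    obtain c d where cd: "c < d" "d < N" "g = {v c, v d}" using ind[OF fg(2)] by (elim exE conjE)
    have "crosses f g" using assms(2) fg by (auto simp: crossing_def pairwise_def)
    then have "interleave (a, b) (c, d)"
      unfolding ab(3) cd(3) using crosses_index[OF ab(1,2) cd(1,2)] by blast
    then have "a \<noteq> c" "a \<noteq> d" "b \<noteq> c" "b \<noteq> d" using interleave_distinct by force+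
    then have "v a \<noteq> v c" "v a \<noteq> v d" "v b \<noteq> v c" "v b \<noteq> v d"
      using v_eq_iff[of a c] v_eq_iff[of a d] v_eq_iff[of b c] v_eq_iff[of b d] ab(1,2) cd(1,2) by auto
    then show "disjnt f g" unfolding ab(3) cd(3) by simp
  qed
  then have "card (\<Union>E) = (\<Sum>f\<in>E. card f)"
    using two by (intro card_Union_disjoint) auto
  also have "\<dots> = 2 * l" using two assms(2) by (simp add: crossing_def)
  finally show ?thesis .
qed

end

context star_frame
begin

lemma edges_mono_tail: "edges (v ` {1..<N}) \<subseteq> edges V"
  by (rule edges_mono) auto

text \<open>Beyond column \<open>k\<close>, an edge of row \<open>a \<le> k\<close> stays put twice
  up to the column \<open>\<sigma> (k + a)\<close>, and from that column on it goes to row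
  \<open>a - 1\<close> and back. At the column itself both routes exist and lead to the same
  edge.\<close>

lemma flat_infl:
  assumes T: "T \<subseteq> edges (v ` {1..<N})"
  shows "flat (infl T) = T"
proof (rule edge_sets_eqI)
  have iT: "infl T \<subseteq> edges V" using infl_edges[OF T] .
  then have fT: "flat (infl T) \<subseteq> edges (v ` {1..<N})" by (rule flat_edges)
  then show "flat (infl T) \<subseteq> edges V" "T \<subseteq> edges V" using edges_mono_tail T by order+
  fix a b assume ab: "a < b" "b < N"
  show "{v a, v b} \<in> flat (infl T) \<longleftrightarrow> {v a, v b} \<in> T"
  proof (cases "a = 0")
    case True
    have "{1..<N} \<subseteq> {..<N}" by auto
    then have "{v a, v b} \<notin> edges (v ` {1..<N})" using chord_mem_edges[of "{1..<N}", OF _ ab] True by auto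
    then show ?thesis using fT T by blast
  next
    case False
    then obtain c where c: "a = Suc c" by (cases a) auto
    have flat: "{v a, v b} \<in> flat (infl T) \<longleftrightarrow>
      (if k < a \<or> b \<le> k then {v a, v b} \<in> infl T
       else b \<le> \<sigma> (k + a) \<and> {v a, v b} \<in> infl T \<or> \<sigma> (k + a) \<le> b \<and> {v c, v b} \<in> infl T)"
      using flat_index[OF iT _ ab] c by simp
    show ?thesis
    proof (cases "k < a \<or> b \<le> k")
      case True
      have "k < b" if "\<sigma> (k + a + 1) \<le> b" "a < k" using that \<sigma>_gt[of "k + a + 1"] by simp
      then have "{v a, v b} \<in> infl T \<longleftrightarrow> {v a, v b} \<in> T"
        unfolding infl_index[OF T ab] using False True by linarith
      then show ?thesis using flat True by simp
    next
      case mid: False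
      have less: "\<sigma> (k + a) < \<sigma> (k + a + 1)" "\<sigma> (k + c) < \<sigma> (k + a)"
        using \<sigma>_less[of "k + a" "k + a + 1"] \<sigma>_less[of "k + c" "k + a"] mid c by auto
      have "{v a, v b} \<in> infl T \<longleftrightarrow> {v a, v b} \<in> T" if "b \<le> \<sigma> (k + a)"
        unfolding infl_index[OF T ab] using that less mid False by linarith
      moreover have "{v c, v b} \<in> infl T \<longleftrightarrow> {v a, v b} \<in> T" if "\<sigma> (k + a) \<le> b"
      proof -
        have cb: "c < b" "k + c + 1 = k + a" "c + 1 = a" using ab c by auto
        then show ?thesis
          unfolding infl_index[OF T cb(1) ab(2)] cb(2,3) using that less mid c by linarith
      qed
      ultimately show ?thesis using flat mid by (meson le_cases)
    qed
  qed
qed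

text \<open>The column \<open>\<sigma> (k + i)\<close> lies in both ranges of the inflating, so each
  edge of the crossing is doubled into two edges of the star.\<close>

lemma star_subset_infl:
  assumes T: "T \<subseteq> edges (v ` {1..<N})" and glue: "glue \<subseteq> T"
  shows "star \<subseteq> infl T"
proof (rule star_subset)
  show "{v 0, v k} \<in> infl T" using infl_index[OF T, of 0 k] k_pos N_ge by simp
  fix i assume i: "1 \<le> i" "i \<le> k"
  have "{s i, s (k + i)} \<in> glue" unfolding glue_def using i by force
  then have iT: "{v i, v (\<sigma> (k + i))} \<in> T" using glue i s_v[of i] s_\<sigma>[of "k + i"] by auto
  have \<sigma>: "k < \<sigma> (k + i)" "\<sigma> (k + i) < N" using \<sigma>_gt[of "k + i"] \<sigma>_N[of "k + i"] i by auto
  show "{v i, v (\<sigma> (k + i))} \<in> infl T"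
    using infl_index[OF T, of i "\<sigma> (k + i)"] iT i \<sigma> by simp
  obtain c where c: "i = Suc c" using i by (cases i) auto
  show "{v (i - 1), v (\<sigma> (k + i))} \<in> infl T"
    using infl_index[OF T, of c "\<sigma> (k + i)"] iT i \<sigma> c by simp
qed

text \<open>In the inflated set, only kept and moved edges join a row to a column beyond
  \<open>k\<close>, so nothing falls between the two thresholds.\<close>

lemma infl_no_bisector:
  assumes T: "T \<subseteq> edges (v ` {1..<N})" and "i \<le> k" "k < t" "t < N" "{v i, v t} \<in> infl T"
  shows "t \<le> \<sigma> (k + i) \<or> \<sigma> (k + i + 1) \<le> t"
  using assms(2-) infl_index[OF T, of i t] by linarith

lemma flattening_inflating:
  assumes T: "T \<subseteq> edges (v ` {1..<N})" and glue: "glue \<subseteq> T"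
  shows "flattening k V (inflating k T glue (s 1) (s 0)) {v 0, v k} = T"
proof -
  have "star_vertex k V (infl T) {v 0, v k} = s"
    using infl_edges[OF T] infl_no_bisector[OF T] star_subset_infl[OF T glue] by (rule star_vertex_eq)
  then have "flattening k V (infl T) {v 0, v k} = flat (infl T)"
    by (simp add: flattening_def flat_def)
  then show ?thesis using flat_infl[OF T] by (simp add: infl_def)
qed

end

text \<open>Enumerating from \<open>s0\<close> turns \<open>s0\<close> and the vertices of
  \<open>E\<close> into the index sequence of a star frame whose glued edges are
  \<open>E\<close>.\<close>

lemma flattening_inflating_inverse:
  assumes k: "1 \<le> k" and P: "polygon n V" and T: "k_triangulation k V T"
    and E: "consecutive_crossing k V T E s1" and new: "new_vertex V s1 s0"
  shows "flattening k (insert s0 V) (inflating k T E s1 s0) {s0, crossing_vertex E s1 s0 k} = T"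
proof -
  have T_edges: "T \<subseteq> edges V" using T by (simp add: k_triangulation_def)
  have V: "finite V" "V \<subseteq> sphere 0 1" "card V = n" using P by (auto simp: polygon_def)
  obtain p where p: "p \<in> V" "ccw_succ V p = s1" "s0 \<in> arc_oo p s1"
    using new by (auto simp: new_vertex_def)
  have s0_circle: "s0 \<in> sphere 0 1" using p(3) by (simp add: arc_oo_def)
  \<comment> \<open>A vertex on the open arc from \<open>p\<close> to \<open>s1\<close> would be
    closer to \<open>p\<close> than its successor.\<close>
  have "s0 \<notin> V"
  proof
    assume "s0 \<in> V"
    moreover have "ang p p = 0" using ang_self p(1) V by auto
    ultimately have mem: "s0 \<in> V - {p}" using p(3) by (auto simp: arc_oo_def)
    have "\<not> ang p s0 < ang p s1"
      using arg_min_if_finite(2)[of "V - {p}" "ang p"] mem V(1) p(2) unfolding ccw_succ_def by auto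
    then show False using p(3) by (simp add: arc_oo_def)
  qed
  define N where "N = n + 1"
  obtain v where v: "ccw_enum v N" "v 0 = s0" "insert s0 V = v ` {..<N}"
    using ccw_enum_exists[of "insert s0 V" s0 N] V s0_circle \<open>s0 \<notin> V\<close> unfolding N_def by auto
  interpret ccw_enum v N by (rule v(1))
  have Vtail: "V = v ` {1..<N}"
  proof -
    have "V = v ` {..<N} - v ` {0}" using v(2,3) \<open>s0 \<notin> V\<close> by auto
    also have "\<dots> = v ` ({..<N} - {0})"
      using inj_on_image_set_diff[OF inj_v, of "{..<N}" "{0}"] by (simp add: N_def)
    also have "{..<N} - {0} = {1..<N}" by auto
    finally show ?thesis .
  qed
  have E': "E \<subseteq> T" "crossing k E" "s1 \<in> \<Union>E"
    "E = {{shift (\<Union>E) s1 (i - 1), shift (\<Union>E) s1 (k + i - 1)} | i. i \<in> {1..k}}"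
    "shift (\<Union>E) s1 (k - 1) = shift V s1 (k - 1)"
    using E unfolding consecutive_crossing_def by blast+
  define U where "U = \<Union>E"
  have "E \<subseteq> edges V" using E'(1) T_edges by order
  moreover have "edges V \<subseteq> edges (v ` {..<N})" unfolding v(3)[symmetric] by (rule edges_mono) auto
  ultimately have "E \<subseteq> edges (v ` {..<N})" by order
  then have cU: "card U = 2 * k" using card_Union_crossing E'(2) by (simp add: U_def)
  have UV: "U \<subseteq> V" using \<open>E \<subseteq> edges V\<close> by (auto simp: U_def edges_def)
  then have n: "2 * k \<le> n" using card_mono[OF V(1)] cU V(3) by metis
  have N3: "3 \<le> N" using n k by (simp add: N_def)
  have s1: "s1 = v 1" using new_vertex_first[OF N3] new v(2) Vtail by simp
  have "s0 \<notin> U" "finite U" using UV \<open>s0 \<notin> V\<close> finite_subset[OF UV V(1)] by auto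
  then have W: "insert s0 U \<subseteq> v ` {..<N}" "v 0 \<in> insert s0 U" "card (insert s0 U) = 2 * k + 1"
    using cU UV v(2,3) by auto
  obtain \<tau> where \<tau>: "\<tau> 0 = 0" "\<And>i j. i < j \<Longrightarrow> j < 2 * k + 1 \<Longrightarrow> \<tau> i < \<tau> j"
    "\<And>j. j < 2 * k + 1 \<Longrightarrow> \<tau> j < N" "insert s0 U = (\<lambda>j. v (\<tau> j)) ` {..<2 * k + 1}"
    using subset_enum[OF W] by blast
  interpret u: ccw_enum "\<lambda>j. v (\<tau> j)" "2 * k + 1"
    by (rule ccw_enum_sub) (use \<tau> in auto)
  have U_image: "U = (\<lambda>j. v (\<tau> j)) ` {1..<2 * k + 1}"
  proof -
    have "U = (\<lambda>j. v (\<tau> j)) ` {..<2 * k + 1} - (\<lambda>j. v (\<tau> j)) ` {0}"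
      using \<tau>(1,4) v(2) \<open>s0 \<notin> V\<close> UV by auto
    also have "\<dots> = (\<lambda>j. v (\<tau> j)) ` ({..<2 * k + 1} - {0})"
      using inj_on_image_set_diff[OF u.inj_v, of "{..<2 * k + 1}" "{0}"] by simp
    also have "{..<2 * k + 1} - {0} = {1..<2 * k + 1}" by auto
    finally show ?thesis .
  qed
  have \<tau>1: "\<tau> 1 = 1"
  proof -
    obtain j where j: "1 \<le> j" "j < 2 * k + 1" "v 1 = v (\<tau> j)"
      using E'(3) s1 U_image unfolding U_def[symmetric] by auto
    then have "\<tau> j = 1" using v_eq_iff[of 1 "\<tau> j"] \<tau>(3)[of j] N3 by simp
    then show ?thesis
      using \<tau>(1) \<tau>(2)[of 0 1] \<tau>(2)[of 1 j] j k by (cases "j = 1") auto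
  qed
  have shift_U: "shift U s1 j = v (\<tau> (j + 1))" if "j < 2 * k" for j
    using u.shift_tail[of j] that k U_image \<tau>1 s1 by simp
  \<comment> \<open>Here the vertices being consecutive enters: the same \<open>k - 1\<close> steps
    from \<open>s1\<close> lead to the same vertex in \<open>U\<close> and in
    \<open>V\<close>.\<close>
  have "\<tau> k = k"
  proof -
    have "v (\<tau> k) = v k"
      using E'(5) shift_U[of "k - 1"] shift_tail[of "k - 1"] N3 n k s1 Vtail
      unfolding U_def[symmetric] by (simp add: N_def)
    then show ?thesis using v_eq_iff[of "\<tau> k" k] \<tau>(3)[of k] n by (simp add: N_def)
  qed
  then have \<tau>_id: "\<tau> j = j" if "j \<le> k" for j
    using strict_gap[of "2 * k + 1" \<tau> 0 j] strict_gap[of "2 * k + 1" \<tau> j k] \<tau>(1,2) that by auto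
  define \<sigma> where "\<sigma> = (\<lambda>j. if j \<le> 2 * k then \<tau> j else N)"
  interpret star_frame v N k \<sigma>
    by unfold_locales (use k \<tau> \<tau>_id in \<open>auto simp: \<sigma>_def\<close>)
  have s\<tau>: "s j = v (\<tau> j)" if "j \<le> 2 * k" for j using s_\<sigma>[OF that] that by (simp add: \<sigma>_def)
  have s01: "s 0 = s0" "s 1 = s1" using s_v[of 0] s_v[of 1] k v(2) s1 by auto
  have "E = glue"
  proof -
    have "{shift U s1 (i - 1), shift U s1 (k + i - 1)} = {s i, s (k + i)}" if i: "i \<in> {1..k}" for i
    proof -
      obtain c where "i = Suc c" using i by (cases i) auto
      then show ?thesis using shift_U[of c] shift_U[of "k + c"] s\<tau>[of i] s\<tau>[of "k + i"] i by simp
    qed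
    then have "{{shift U s1 (i - 1), shift U s1 (k + i - 1)} | i. i \<in> {1..k}} = glue"
      unfolding glue_def Setcompr_eq_image by (intro image_cong) simp_all
    then show ?thesis using E'(4) unfolding U_def[symmetric] by simp
  qed
  then have "flattening k (v ` {..<N}) (inflating k T E s1 s0) {v 0, v k} = T"
    using flattening_inflating[of T] T_edges E'(1) unfolding Vtail s01 by simp
  moreover have "crossing_vertex E s1 s0 k = v k"
    using crossing_vertex_glue[of k] s01 s_v[of k] \<open>E = glue\<close> by simp
  ultimately show ?thesis using v(2,3) by simp
qed

section \<open>Inflating after flattening\<close>

text \<open>Interface between finding the star and the round trip: the edges of the star, the edges
  at \<open>v 0\<close> that flattening forgets, and the empty angles.\<close>

locale starred_triangulation = star_frame +
  fixes T :: "complex set set"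
  assumes T_edges: "T \<subseteq> edges (v ` {..<N})"
    and spoke: "\<And>i. 1 \<le> i \<Longrightarrow> i \<le> k \<Longrightarrow> {v 0, v i} \<in> T"
    and right: "\<And>i. 1 \<le> i \<Longrightarrow> i \<le> k \<Longrightarrow> {v i, v (\<sigma> (k + i))} \<in> T"
    and left: "\<And>i. 1 \<le> i \<Longrightarrow> i \<le> k \<Longrightarrow> {v (i - 1), v (\<sigma> (k + i))} \<in> T"
    and no_bisector: "\<And>i t. i \<le> k \<Longrightarrow> k < t \<Longrightarrow> t < N \<Longrightarrow> {v i, v t} \<in> T \<Longrightarrow>
      t \<le> \<sigma> (k + i) \<or> \<sigma> (k + i + 1) \<le> t"
begin

lemma star_vertex_T: "star_vertex k V T {v 0, v k} = s"
proof (rule star_vertex_eq[OF T_edges no_bisector])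
  show "star \<subseteq> T" by (rule star_subset) (use spoke left right k_pos in auto)
qed

lemma flattening_T: "flattening k V T {v 0, v k} = flat T"
  by (simp add: flattening_def flat_def star_vertex_T)

text \<open>Inflating restores the forgotten edges, all of which belong to \<open>T\<close>. Gluing
  loses no information because \<open>right\<close> and \<open>left\<close> place both preimages in
  \<open>T\<close>, and by \<open>no_bisector\<close> every other edge between a row and a far
  column is kept or moved.\<close>

lemma infl_flat: "infl (flat T) = T"
proof (rule edge_sets_eqI)
  have fT: "flat T \<subseteq> edges (v ` {1..<N})" by (rule flat_edges[OF T_edges])
  show "infl (flat T) \<subseteq> edges V" by (rule infl_edges[OF fT])
  show "T \<subseteq> edges V" by (rule T_edges)
  fix a b assume ab: "a < b" "b < N"
  show "{v a, v b} \<in> infl (flat T) \<longleftrightarrow> {v a, v b} \<in> T"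
  proof (cases "a \<le> k \<and> k < b")
    case False
    have "k < b" if "\<sigma> (k + a + 1) \<le> b" "a < k" using that \<sigma>_gt[of "k + a + 1"] by simp
    moreover have "{v a, v b} \<in> flat T \<longleftrightarrow> {v a, v b} \<in> T" if "1 \<le> a"
      using flat_index[OF T_edges that ab] False by auto
    moreover have "{v a, v b} \<in> T" if "a = 0" "b \<le> k" using spoke[of b] that ab by simp
    ultimately show ?thesis unfolding infl_index[OF fT ab] using False by linarith
  next
    case mid: True
    have keep: "{v a, v b} \<in> flat T \<longleftrightarrow> {v a, v b} \<in> T" if "1 \<le> a" "b \<le> \<sigma> (k + a)"
    proof -
      have "{v a, v b} \<in> T" if "\<sigma> (k + a) \<le> b"
        using right[of a] \<open>1 \<le> a\<close> \<open>b \<le> \<sigma> (k + a)\<close> that mid by simp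
      then show ?thesis using flat_index[OF T_edges that(1) ab] that mid by auto
    qed
    have move: "{v (a + 1), v b} \<in> flat T \<longleftrightarrow> {v a, v b} \<in> T" if "a < k" "\<sigma> (k + a + 1) \<le> b"
    proof -
      have "a + 1 < b" using that \<sigma>_gt[of "k + a + 1"] by simp
      moreover have "{v a, v b} \<in> T" if "b \<le> \<sigma> (k + (a + 1))"
        using left[of "a + 1"] \<open>a < k\<close> \<open>\<sigma> (k + a + 1) \<le> b\<close> that by simp
      ultimately show ?thesis using flat_index[OF T_edges _ _ ab(2), of "a + 1"] that mid by auto
    qed
    have "b \<le> \<sigma> (k + a) \<or> \<sigma> (k + a + 1) \<le> b" if "{v a, v b} \<in> T"
      using no_bisector[of a b] mid ab that by simp
    moreover have "1 \<le> a" if "b \<le> \<sigma> (k + a)" using that mid \<sigma>_id[of k] by (cases "a = 0") auto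
    moreover have "a < k" if "\<sigma> (k + a + 1) \<le> b" using moved_less_k[of a b] that mid ab by simp
    ultimately show ?thesis unfolding infl_index[OF fT ab] using mid keep move by auto
  qed
qed

lemma flatten_step_cases:
  assumes "a < b" "b < N" "flatten_step k s {v a, v b} g"
  obtains "g = {v a, v b}" "a \<le> k \<Longrightarrow> k < b \<Longrightarrow> b \<le> \<sigma> (k + a)"
    | "a < k" "k < b" "\<sigma> (k + (a + 1)) \<le> b" "g = {v (a + 1), v b}"
  using assms(3) moved_less_k[of a b] assms(2) unfolding flatten_step_index[OF assms(1,2)]
  by (elim disjE conjE) (simp_all add: add.assoc)

lemma T_chord:
  assumes "f \<in> T"
  obtains a b where "a < b" "b < N" "f = {v a, v b}"
  using subsetD[OF T_edges assms] unfolding edges_index[OF order_refl] by auto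

lemma glue_preimage:
  assumes i: "i \<in> {1..k}"
  shows "{f \<in> T. flatten_step k s f {s i, s (k + i)}} = {{s (i - 1), s (k + i)}, {s i, s (k + i)}}"
proof -
  obtain c where c: "i = Suc c" using i by (cases i) auto
  have \<sigma>: "k < \<sigma> (k + i)" "\<sigma> (k + i) < N" using \<sigma>_gt[of "k + i"] \<sigma>_N[of "k + i"] i by auto
  have s: "s i = v i" "s (i - 1) = v c" "s (k + i) = v (\<sigma> (k + i))"
    using s_v[of i] s_v[of c] s_\<sigma>[of "k + i"] i c by auto
  have lt: "i < \<sigma> (k + i)" "c < \<sigma> (k + i)" using \<sigma> i c by auto
  show ?thesis
  proof (intro subset_antisym subsetI)
    fix f assume "f \<in> {f \<in> T. flatten_step k s f {s i, s (k + i)}}"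
    then have f: "f \<in> T" "flatten_step k s f {v i, v (\<sigma> (k + i))}" using s by auto
    obtain a b where ab: "a < b" "b < N" "f = {v a, v b}" using f(1) by (rule T_chord)
    from ab(1,2) f(2)[unfolded ab(3)] have "f = {v i, v (\<sigma> (k + i))} \<or> f = {v c, v (\<sigma> (k + i))}"
    proof (cases rule: flatten_step_cases)
      case 1
      then show ?thesis using ab(3) by simp
    next
      case 2
      then have "a + 1 < b" by simp
      then have "i = a + 1 \<and> \<sigma> (k + i) = b"
        using 2(4) chord_eq_iff[OF lt(1) \<sigma>(2) _ ab(2)] by blast
      then have "c = a" "\<sigma> (k + i) = b" using c by auto
      then show ?thesis using ab(3) by blast
    qed
    then show "f \<in> {{s (i - 1), s (k + i)}, {s i, s (k + i)}}" using s by auto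
  next
    fix f assume "f \<in> {{s (i - 1), s (k + i)}, {s i, s (k + i)}}"
    then have "f = {v c, v (\<sigma> (k + i))} \<or> f = {v i, v (\<sigma> (k + i))}" using s by auto
    moreover have "flatten_step k s {v i, v (\<sigma> (k + i))} {v i, v (\<sigma> (k + i))}"
      using flatten_step_index[OF lt(1) \<sigma>(2)] \<sigma> i by simp
    moreover have "flatten_step k s {v c, v (\<sigma> (k + i))} {v i, v (\<sigma> (k + i))}"
      using flatten_step_index[OF lt(2) \<sigma>(2)] \<sigma> i c by simp
    moreover have "{v i, v (\<sigma> (k + i))} \<in> T" "{v c, v (\<sigma> (k + i))} \<in> T"
      using right[of i] left[of i] i c by auto
    ultimately show "f \<in> {f \<in> T. flatten_step k s f {s i, s (k + i)}}"
      unfolding s mem_Collect_eq by (elim disjE) simp_all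
  qed
qed

lemma glue_mem: "1 \<le> i \<Longrightarrow> i \<le> k \<Longrightarrow> {v i, v (\<sigma> (k + i))} \<in> glue"
  using s_v[of i] s_\<sigma>[of "k + i"] unfolding glue_def by force

text \<open>Keeping and moving are each injective, so a glued edge has one kept and one moved
  preimage. The two ranges meet only at the threshold column.\<close>

lemma glued_edges_T: "glued_edges k V T {v 0, v k} = glue"
proof (intro subset_antisym subsetI)
  fix g assume "g \<in> glued_edges k V T {v 0, v k}"
  then obtain f f' where f: "f \<in> T" "f' \<in> T" "f \<noteq> f'" "flatten_step k s f g" "flatten_step k s f' g"
    unfolding glued_edges_def star_vertex_T by blast
  obtain a b where ab: "a < b" "b < N" "f = {v a, v b}" using f(1) by (rule T_chord)
  obtain c d where cd: "c < d" "d < N" "f' = {v c, v d}" using f(2) by (rule T_chord)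
  have mixed: "{v a, v b} \<in> glue"
    if "a < b" "b < N" "c < d" "d < N" "a \<le> k \<Longrightarrow> k < b \<Longrightarrow> b \<le> \<sigma> (k + a)"
      "c < k" "k < d" "\<sigma> (k + (c + 1)) \<le> d" "{v a, v b} = {v (c + 1), v d}" for a b c d
  proof -
    have "a = c + 1 \<and> b = d" using chord_eq_iff[of a b "c + 1" d] that by simp
    then have "b = \<sigma> (k + a)" "1 \<le> a" "a \<le> k" using that by auto
    then show ?thesis using glue_mem by simp
  qed
  from ab(1,2) f(4)[unfolded ab(3)] show "g \<in> glue"
  proof (cases rule: flatten_step_cases)
    case f1: 1
    from cd(1,2) f(5)[unfolded cd(3)] show ?thesis
    proof (cases rule: flatten_step_cases)
      case 1
      then show ?thesis using f1(1) f(3) ab(3) cd(3) by simp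
    next
      case 2
      then have "{v a, v b} \<in> glue" using mixed[of a b c d] f1 ab(1,2) cd(1,2) by simp
      then show ?thesis using f1 by simp
    qed
  next
    case f2: 2
    from cd(1,2) f(5)[unfolded cd(3)] show ?thesis
    proof (cases rule: flatten_step_cases)
      case 1
      then have "{v c, v d} \<in> glue" using mixed[of c d a b] f2 ab(1,2) cd(1,2) by simp
      then show ?thesis using 1 by simp
    next
      case 2
      then have "a = c \<and> b = d"
        using f2 chord_eq_iff[of "a + 1" b "c + 1" d] ab(1,2) cd(1,2) by simp
      then show ?thesis using f(3) ab(3) cd(3) by simp
    qed
  qed
next
  fix g assume "g \<in> glue"
  then obtain i where i: "i \<in> {1..k}" "g = {s i, s (k + i)}" unfolding glue_def by auto
  have \<sigma>: "k < \<sigma> (k + i)" "\<sigma> (k + i) < N" using \<sigma>_gt[of "k + i"] \<sigma>_N[of "k + i"] i by auto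
  have "{s (i - 1), s (k + i)} \<noteq> {s i, s (k + i)}"
    using chord_eq_iff[of "i - 1" "\<sigma> (k + i)" i "\<sigma> (k + i)"] s_v[of "i - 1"] s_v[of i] s_\<sigma>[of "k + i"] \<sigma> i
    by auto
  moreover have "{s (i - 1), s (k + i)} \<in> T \<and> flatten_step k s {s (i - 1), s (k + i)} g"
    "{s i, s (k + i)} \<in> T \<and> flatten_step k s {s i, s (k + i)} g"
    using glue_preimage[OF i(1)] i(2) by auto
  ultimately show "g \<in> glued_edges k V T {v 0, v k}"
    unfolding glued_edges_def star_vertex_T mem_Collect_eq
    by (intro bexI[of _ "{s (i - 1), s (k + i)}"] bexI[of _ "{s i, s (k + i)}"] conjI) (elim conjE; assumption)+
qed

lemma glue_subset_flat: "glue \<subseteq> flat T"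
proof
  fix g assume "g \<in> glue"
  then obtain i where i: "i \<in> {1..k}" "g = {s i, s (k + i)}" unfolding glue_def by auto
  then have "{s i, s (k + i)} \<in> T \<and> flatten_step k s {s i, s (k + i)} g"
    using glue_preimage[OF i(1)] by auto
  then show "g \<in> flat T" unfolding flat_def by blast
qed

lemma crossing_glue: "crossing k glue"
proof -
  define C where "C = (\<lambda>i. (i, \<sigma> (k + i))) ` {1..k}"
  have up: "interleave (i, \<sigma> (k + i)) (j, \<sigma> (k + j))" if "1 \<le> i" "i < j" "j \<le> k" for i j
    using that \<sigma>_less[of "k + i" "k + j"] \<sigma>_gt[of "k + i"] by (auto simp: interleave_def)
  have "index_crossing (card {1..k}) C"
    unfolding C_def
  proof (rule index_crossing_image)
    fix i j assume "i \<in> {1..k}" "j \<in> {1..k}" "i \<noteq> j"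
    then show "interleave (i, \<sigma> (k + i)) (j, \<sigma> (k + j))"
      using up[of i j] up[of j i] by (auto simp: interleave_def neq_iff)
  qed simp
  moreover have "C \<subseteq> {(a, b). a < b \<and> b < N}"
  proof
    fix x assume "x \<in> C"
    then obtain i where i: "1 \<le> i" "i \<le> k" "x = (i, \<sigma> (k + i))" unfolding C_def by auto
    then show "x \<in> {(a, b). a < b \<and> b < N}" using \<sigma>_gt[of "k + i"] \<sigma>_N[of "k + i"] by auto
  qed
  moreover have "chord ` C = glue"
  proof -
    have "{v i, v (\<sigma> (k + i))} = {s i, s (k + i)}" if "i \<in> {1..k}" for i
      using s_v[of i] s_\<sigma>[of "k + i"] that by simp
    then have "chord ` C = (\<lambda>i. {s i, s (k + i)}) ` {1..k}"
      unfolding C_def image_image by (intro image_cong) auto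
    then show ?thesis unfolding glue_def image_def by blast
  qed
  ultimately show ?thesis using crossing_index[of C k] by simp
qed

lemma consecutive_crossing_glue: "consecutive_crossing k (v ` {1..<N}) (flat T) glue (s 1)"
  unfolding consecutive_crossing_def
proof (intro conjI)
  show "glue \<subseteq> flat T" by (rule glue_subset_flat)
  show "crossing k glue" by (rule crossing_glue)
  show "s 1 \<in> \<Union>glue" unfolding Union_glue using k_pos by (intro image_eqI[of _ _ 0]) auto
  have "{shift (\<Union>glue) (s 1) (i - 1), shift (\<Union>glue) (s 1) (k + i - 1)} = {s i, s (k + i)}"
    if i: "i \<in> {1..k}" for i
  proof -
    obtain c where "i = Suc c" using i by (cases i) auto
    then show ?thesis using shift_glue[of c] shift_glue[of "k + c"] i by simp
  qed
  then have "(\<lambda>i. {shift (\<Union>glue) (s 1) (i - 1), shift (\<Union>glue) (s 1) (k + i - 1)}) ` {1..k} =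
      (\<lambda>i. {s i, s (k + i)}) ` {1..k}"
    by (intro image_cong) simp_all
  moreover have "glue = (\<lambda>i. {s i, s (k + i)}) ` {1..k}"
    by (simp only: glue_def Setcompr_eq_image)
  ultimately show "glue = {{shift (\<Union>glue) (s 1) (i - 1), shift (\<Union>glue) (s 1) (k + i - 1)} | i. i \<in> {1..k}}"
    unfolding Setcompr_eq_image by order
  have "3 \<le> N" "k - 1 < N - 1" using N_ge k_pos by auto
  then show "shift (\<Union>glue) (s 1) (k - 1) = shift (v ` {1..<N}) (s 1) (k - 1)"
    using shift_glue[of "k - 1"] shift_tail[of "k - 1"] s_v[of 1] s_v[of k] k_pos by simp
qed

end

section \<open>Existence of the star through a boundary edge\<close>

lemma boundary_edge_shift:
  assumes V: "finite V" "V \<subseteq> sphere 0 1" "2 \<le> card V" and e: "boundary_edge k V e"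
  obtains u where "u \<in> V" "e = {u, shift V u k}"
proof -
  obtain x y where xy: "x \<in> V" "y \<in> V" "e = {x, y}"
    using e by (auto simp: boundary_edge_def edges_def)
  obtain v where v: "ccw_enum v (card V)" "v 0 = x" "V = v ` {..<card V}"
    using ccw_enum_exists[OF V(1,2) xy(1) refl] by blast
  obtain j where j: "j < card V" "y = v j" using xy(2) v(3) by (metis imageE lessThan_iff)
  then have "shift V x j = y"
    using ccw_enum.shift_index[OF v(1) V(3), of 0 j] v(2,3) by simp
  \<comment> \<open>The \<open>LEAST\<close> in \<open>edge_length\<close> is attained only if some
    number of steps joins the two ends.\<close>
  then have "\<exists>j. \<exists>u\<in>V. e = {u, shift V u j}" using xy by blast
  then have "\<exists>u\<in>V. e = {u, shift V u (edge_length V e)}"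
    unfolding edge_length_def by (rule LeastI_ex)
  then show ?thesis using e that by (auto simp: boundary_edge_def)
qed

lemma boundary_star_exists:
  assumes k: "1 \<le> k" and P: "polygon N W" and N: "2 * k + 1 \<le> N" and T: "k_triangulation k W T"
    and e: "boundary_edge k W e"
  obtains v \<sigma> where "starred_triangulation v N k \<sigma> T" "W = v ` {..<N}" "e = {v 0, v k}"
proof -
  have W: "finite W" "W \<subseteq> sphere 0 1" "card W = N" using P by (auto simp: polygon_def)
  obtain u where u: "u \<in> W" "e = {u, shift W u k}"
    using boundary_edge_shift[OF W(1,2) _ e] W(3) N k by auto
  obtain v where v: "ccw_enum v N" "v 0 = u" "W = v ` {..<N}"
    using ccw_enum_exists[OF W(1,2) u(1) W(3)] by blast
  interpret ccw_enum v N by (rule v(1))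
  have e': "e = {v 0, v k}" using u(2) shift_index[of 0 k] v(2,3) N k by simp
  interpret index_triangulation k N "index_pairs T"
    using T unfolding v(3) by (rule index_triangulation)
  obtain b where "greedy_columns k N (index_pairs T) b" using greedy_columns_exist[OF N] by blast
  then interpret b: greedy_columns k N "index_pairs T" b .
  \<comment> \<open>The greedy columns follow the consecutive vertices \<open>0, \<dots>, k\<close>;
    their end value \<open>b (k + 1) = N\<close> supplies the second index of
    \<open>s\<^sub>0\<close>.\<close>
  define \<sigma> where "\<sigma> = (\<lambda>j. if j \<le> k then j else b (j - k))"
  have \<sigma>_less: "\<sigma> i < \<sigma> j" if "i < j" "j \<le> 2 * k + 1" for i j
  proof -
    have "k < b (j - k)" if "k < j"
    proof (cases "j = 2 * k + 1")
      case True
      then have "j - k = k + 1" by simp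
      then show ?thesis using b.b_end N k by simp
    next
      case False
      then have "1 \<le> j - k" "j - k \<le> k" using \<open>j \<le> 2 * k + 1\<close> that by auto
      then show ?thesis using b.b_ge[of "j - k"] by simp
    qed
    moreover have "b (i - k) < b (j - k)" if "k < i"
      using b.b_strict[of "i - k" "j - k"] \<open>i < j\<close> \<open>j \<le> 2 * k + 1\<close> that by auto
    ultimately show ?thesis using \<open>i < j\<close> by (auto simp: \<sigma>_def)
  qed
  have \<sigma>_b: "\<sigma> (k + i) = b i" if "1 \<le> i" for i using that by (simp add: \<sigma>_def)
  have "starred_triangulation v N k \<sigma> T"
  proof unfold_locales
    show "1 \<le> k" by (rule k)
    show "\<sigma> i < \<sigma> j" if "i < j" "j \<le> 2 * k + 1" for i j using \<sigma>_less that .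
    show "\<sigma> j = j" if "j \<le> k" for j using that by (simp add: \<sigma>_def)
    show "\<sigma> (2 * k + 1) = N" using \<sigma>_b[of "k + 1"] b.b_end by (simp add: mult_2)
    show "T \<subseteq> edges (v ` {..<N})" using T v(3) by (simp add: k_triangulation_def)
    fix i assume i: "i \<le> k"
    show "{v 0, v i} \<in> T" if "1 \<le> i"
      using short_pair[of 0 i] that i N by (simp add: index_pairs_def)
    show "{v i, v (\<sigma> (k + i))} \<in> T" if "1 \<le> i"
      using b.b_mem[OF that i] \<sigma>_b[OF that] by (simp add: index_pairs_def)
    show "{v (i - 1), v (\<sigma> (k + i))} \<in> T" if "1 \<le> i"
      using b.left_of_greedy[OF that i] \<sigma>_b[OF that] by (simp add: index_pairs_def)
    show "t \<le> \<sigma> (k + i) \<or> \<sigma> (k + i + 1) \<le> t" if "k < t" "t < N" "{v i, v t} \<in> T" for t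
      using b.no_bisector[of i t] that i \<sigma>_b[of i] \<sigma>_b[of "i + 1"] by (auto simp: index_pairs_def)
  qed
  then show ?thesis using that v(3) e' by blast
qed

theorem theorem7p7:
  fixes k n :: nat
  assumes "1 \<le> k"
  shows
    "(\<forall>V T e s E. polygon (n + 1) V \<and> 2 * k + 1 \<le> n + 1 \<and> k_triangulation k V T \<and>
        e \<in> T \<and> boundary_edge k V e \<and> s = star_vertex k V T e \<and> E = glued_edges k V T e \<longrightarrow>
        E = {{s i, s (k + i)} | i. i \<in> {1..k}} \<and>
        (\<forall>i\<in>{1..k}. {f \<in> T. flatten_step k s f {s i, s (k + i)}} =
           {{s (i - 1), s (k + i)}, {s i, s (k + i)}}) \<and>
        consecutive_crossing k (V - {s 0}) (flattening k V T e) E (s 1) \<and>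
        new_vertex (V - {s 0}) (s 1) (s 0) \<and>
        inflating k (flattening k V T e) E (s 1) (s 0) = T)
     \<and>
     (\<forall>V T E s0 s1 e. polygon n V \<and> k_triangulation k V T \<and>
        consecutive_crossing k V T E s1 \<and> new_vertex V s1 s0 \<and>
        e = {s0, crossing_vertex E s1 s0 k} \<longrightarrow>
        flattening k (insert s0 V) (inflating k T E s1 s0) e = T)"
proof (rule conjI; intro allI impI; elim conjE)
  fix V T e s E
  assume "polygon (n + 1) V" "2 * k + 1 \<le> n + 1" "k_triangulation k V T" "boundary_edge k V e"
    and s: "s = star_vertex k V T e" and E: "E = glued_edges k V T e"
  then obtain v \<sigma> where v: "starred_triangulation v (n + 1) k \<sigma> T" "V = v ` {..<n + 1}" "e = {v 0, v k}"
    using boundary_star_exists[OF assms] by metis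
  interpret F: starred_triangulation v "n + 1" k \<sigma> T by (rule v(1))
  have sF: "s = F.s" using F.star_vertex_T s v by simp
  have EF: "E = F.glue" using F.glued_edges_T E v by simp
  have fF: "flattening k V T e = F.flat T" using F.flattening_T v by simp
  have VF: "V - {F.s 0} = v ` {1..<n + 1}"
  proof -
    have "V - {F.s 0} = v ` {..<n + 1} - v ` {0}" using v(2) F.s_v[of 0] by simp
    also have "\<dots> = v ` ({..<n + 1} - {0})"
      using inj_on_image_set_diff[OF F.inj_v, of "{..<n + 1}" "{0}"] by simp
    also have "{..<n + 1} - {0} = {1..<n + 1}" by auto
    finally show ?thesis .
  qed
  have "new_vertex (v ` {1..<n + 1}) (F.s 1) (F.s 0)"
    using F.new_vertex_tail F.N_ge F.s_v[of 0] F.s_v[of 1] assms by simp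
  then show "E = {{s i, s (k + i)} | i. i \<in> {1..k}} \<and>
      (\<forall>i\<in>{1..k}. {f \<in> T. flatten_step k s f {s i, s (k + i)}} =
         {{s (i - 1), s (k + i)}, {s i, s (k + i)}}) \<and>
      consecutive_crossing k (V - {s 0}) (flattening k V T e) E (s 1) \<and>
      new_vertex (V - {s 0}) (s 1) (s 0) \<and>
      inflating k (flattening k V T e) E (s 1) (s 0) = T"
    unfolding sF EF fF VF
    using F.glue_preimage F.consecutive_crossing_glue F.infl_flat[unfolded F.infl_def]
    by (intro conjI ballI) (auto simp only: F.glue_def)
next
  fix V T E s0 s1 e
  assume "polygon n V" "k_triangulation k V T" "consecutive_crossing k V T E s1" "new_vertex V s1 s0"
    and e: "e = {s0, crossing_vertex E s1 s0 k}"
  then show "flattening k (insert s0 V) (inflating k T E s1 s0) e = T"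
    unfolding e using flattening_inflating_inverse[OF assms] by blast
qed

end
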